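(* Let $\Lambda$ be a finite dimensional algebra over a field $k$ and let $\mathcal C$ be a full exact extension-closed subcategory of $\operatorname{mod}\Lambda$ which has Auslander-Reiten sequences. Let $\mathcal E:0\to X\stackrel{u}{\to}Y\to Z\to 0$ be a non-split short exact sequence in $\mathcal C$ with $Z$ indecomposable. Then for any $M\in\mathcal C$, the bilinear form given by composition $$\operatorname{Hom}_\Lambda(M,\tau Z)\times\operatorname{Cok}(u,M)\longrightarrow\operatorname{Cok}(u,\tau Z)$$ is right non-degenerate, i.e. for every nonzero element $\bar f\in\operatorname{Cok}(u,M)$ there is $g\in\operatorname{Hom}_\Lambda(M,\tau Z)$ such that $g\bar f\neq 0$ in $\operatorname{Cok}(u,\tau Z)$.
   Context: $\operatorname{mod}\Lambda$ is the category of finite dimensional right $\Lambda$-modules. The exact structure on $\mathcal C$ is given by the short exact sequences of $\Lambda$-modules with all terms in $\mathcal C$. That $\mathcal C$ has Auslander-Reiten sequences means in particular that every indecomposable object $Z$ of $\mathcal C$ which is not projective in $\mathcal C$ is the end term of an Auslander-Reiten (almost split) sequence $0\to\tau Z\to W\to Z\to 0$ in $\mathcal C$; this defines the translate $\tau Z$ (taken in $\mathcal C$). Since the given sequence $\mathcal E$ is non-split, $Z$ is not projective in $\mathcal C$, so $\tau Z$ is defined. For an object $M$, $\operatorname{Cok}(u,M)$ denotes the cokernel of the map $\operatorname{Hom}_\Lambda(u,M):\operatorname{Hom}_\Lambda(Y,M)\to\operatorname{Hom}_\Lambda(X,M)$; the bilinear form sends $(g,\bar f)$, with $\bar f$ the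 class of $f:X\to M$, to the class of $gf:X\to\tau Z$. *)

theory Defs
  imports "HOL-Algebra.Module" "HOL-Algebra.AbelCoset"
begin

section \<open>Finite dimensional algebras and their right modules\<close>

definition fin_dim :: "('k, 'c) ring_scheme \<Rightarrow> ('k, 'v, 'd) module_scheme \<Rightarrow> bool" where
  "fin_dim k V \<longleftrightarrow> (\<exists>B. finite B \<and> B \<subseteq> carrier V \<and>
     (\<forall>v\<in>carrier V. \<exists>c\<in>B \<rightarrow> carrier k. v = (\<Oplus>\<^bsub>V\<^esub>b\<in>B. c b \<odot>\<^bsub>V\<^esub> b)))"

text \<open>The library locales \<open>algebra\<close> and \<open>module\<close> are restricted to commutative rings; here the
  algebra \<open>\<Lambda>\<close> is unital and associative, but need not be commutative.\<close>

locale fd_algebra =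
  field k + module k \<Lambda> + \<Lambda>: ring \<Lambda> for k (structure) and \<Lambda> +
  assumes smult_mult_left:
      "\<lbrakk>c \<in> carrier k; x \<in> carrier \<Lambda>; y \<in> carrier \<Lambda>\<rbrakk> \<Longrightarrow>
        (c \<odot>\<^bsub>\<Lambda>\<^esub> x) \<otimes>\<^bsub>\<Lambda>\<^esub> y = c \<odot>\<^bsub>\<Lambda>\<^esub> (x \<otimes>\<^bsub>\<Lambda>\<^esub> y)"
    and smult_mult_right:
      "\<lbrakk>c \<in> carrier k; x \<in> carrier \<Lambda>; y \<in> carrier \<Lambda>\<rbrakk> \<Longrightarrow>
        x \<otimes>\<^bsub>\<Lambda>\<^esub> (c \<odot>\<^bsub>\<Lambda>\<^esub> y) = c \<odot>\<^bsub>\<Lambda>\<^esub> (x \<otimes>\<^bsub>\<Lambda>\<^esub> y)"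
    and fin_dim: "fin_dim k \<Lambda>"

text \<open>The library's \<open>module\<close> record writes the scalar first, so \<open>a \<odot>\<^bsub>M\<^esub> x\<close> stands for the right
  action \<open>x a\<close>; what makes the action a right action is \<open>smult_assoc\<close>, i.e. \<open>x (a b) = (x a) b\<close>.
  The fields \<open>mult\<close> and \<open>one\<close> of that record carry no information.\<close>

locale right_module = \<Lambda>: ring \<Lambda> + abelian_group M
  for \<Lambda> :: "('l, 'd) ring_scheme" and M :: "('l, 'm) module" +
  assumes smult_closed:
      "\<lbrakk>a \<in> carrier \<Lambda>; x \<in> carrier M\<rbrakk> \<Longrightarrow> a \<odot>\<^bsub>M\<^esub> x \<in> carrier M"
    and smult_l_distr:
      "\<lbrakk>a \<in> carrier \<Lambda>; b \<in> carrier \<Lambda>; x \<in> carrier M\<rbrakk> \<Longrightarrow>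
        (a \<oplus>\<^bsub>\<Lambda>\<^esub> b) \<odot>\<^bsub>M\<^esub> x = a \<odot>\<^bsub>M\<^esub> x \<oplus>\<^bsub>M\<^esub> b \<odot>\<^bsub>M\<^esub> x"
    and smult_r_distr:
      "\<lbrakk>a \<in> carrier \<Lambda>; x \<in> carrier M; y \<in> carrier M\<rbrakk> \<Longrightarrow>
        a \<odot>\<^bsub>M\<^esub> (x \<oplus>\<^bsub>M\<^esub> y) = a \<odot>\<^bsub>M\<^esub> x \<oplus>\<^bsub>M\<^esub> a \<odot>\<^bsub>M\<^esub> y"
    and smult_assoc:
      "\<lbrakk>a \<in> carrier \<Lambda>; b \<in> carrier \<Lambda>; x \<in> carrier M\<rbrakk> \<Longrightarrow>
        (a \<otimes>\<^bsub>\<Lambda>\<^esub> b) \<odot>\<^bsub>M\<^esub> x = b \<odot>\<^bsub>M\<^esub> (a \<odot>\<^bsub>M\<^esub> x)"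
    and smult_one: "x \<in> carrier M \<Longrightarrow> \<one>\<^bsub>\<Lambda>\<^esub> \<odot>\<^bsub>M\<^esub> x = x"

definition underlying_space ::
  "('k, 'l, 'd) module_scheme \<Rightarrow> ('l, 'm) module \<Rightarrow> ('k, 'm) module" where
  "underlying_space \<Lambda> M = \<lparr>carrier = carrier M, mult = mult M, one = one M,
     zero = zero M, add = add M, smult = (\<lambda>c x. (c \<odot>\<^bsub>\<Lambda>\<^esub> \<one>\<^bsub>\<Lambda>\<^esub>) \<odot>\<^bsub>M\<^esub> x)\<rparr>"

text \<open>The objects of \<open>mod \<Lambda>\<close> whose elements have type \<open>'m\<close>.\<close>

definition mod_cat ::
  "('k, 'c) ring_scheme \<Rightarrow> ('k, 'l, 'd) module_scheme \<Rightarrow> ('l, 'm) module set" where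
  "mod_cat k \<Lambda> = {M. right_module \<Lambda> M \<and> fin_dim k (underlying_space \<Lambda> M)}"

text \<open>Homomorphisms are extensional functions (\<open>undefined\<close> outside the carrier), so that equality of
  homomorphisms is equality of functions; \<open>compose (carrier X) g f\<close> is the composite \<open>g f\<close>.\<close>

definition mod_hom ::
  "('l, 'd) ring_scheme \<Rightarrow> ('l, 'm) module \<Rightarrow> ('l, 'm) module \<Rightarrow> ('m \<Rightarrow> 'm) set" where
  "mod_hom \<Lambda> M N = {f \<in> hom (add_monoid M) (add_monoid N) \<inter> extensional (carrier M).
     \<forall>a\<in>carrier \<Lambda>. \<forall>x\<in>carrier M. f (a \<odot>\<^bsub>M\<^esub> x) = a \<odot>\<^bsub>N\<^esub> f x}"

definition split_mono ::
  "('l, 'd) ring_scheme \<Rightarrow> ('l, 'm) module \<Rightarrow> ('l, 'm) module \<Rightarrow> ('m \<Rightarrow> 'm) \<Rightarrow> bool" where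
  "split_mono \<Lambda> M N f \<longleftrightarrow>
     (\<exists>r\<in>mod_hom \<Lambda> N M. compose (carrier M) r f = (\<lambda>x\<in>carrier M. x))"

definition split_epi ::
  "('l, 'd) ring_scheme \<Rightarrow> ('l, 'm) module \<Rightarrow> ('l, 'm) module \<Rightarrow> ('m \<Rightarrow> 'm) \<Rightarrow> bool" where
  "split_epi \<Lambda> M N f \<longleftrightarrow>
     (\<exists>s\<in>mod_hom \<Lambda> N M. compose (carrier N) f s = (\<lambda>x\<in>carrier N. x))"

definition short_exact ::
  "('l, 'd) ring_scheme \<Rightarrow> ('l, 'm) module \<Rightarrow> ('m \<Rightarrow> 'm) \<Rightarrow> ('l, 'm) module \<Rightarrow> ('m \<Rightarrow> 'm) \<Rightarrow>
     ('l, 'm) module \<Rightarrow> bool" where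
  "short_exact \<Lambda> X u Y v Z \<longleftrightarrow> u \<in> mod_hom \<Lambda> X Y \<and> v \<in> mod_hom \<Lambda> Y Z \<and>
     inj_on u (carrier X) \<and> u ` carrier X = kernel (add_monoid Y) (add_monoid Z) v \<and>
     v ` carrier Y = carrier Z"

section \<open>Exact subcategories and Auslander-Reiten sequences\<close>

text \<open>A full subcategory is given by its set of objects. Extension-closedness only speaks about
  middle terms with elements in \<open>'m\<close>; for infinite \<open>'m\<close> this is no loss, because every extension
  of two modules over \<open>'m\<close> is then isomorphic to one over \<open>'m\<close>. Together with a zero
  object, extension-closedness gives closure under isomorphism and finite direct sums.\<close>

definition exact_subcategory ::
  "('k, 'c) ring_scheme \<Rightarrow> ('k, 'l, 'd) module_scheme \<Rightarrow> ('l, 'm) module set \<Rightarrow> bool" where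
  "exact_subcategory k \<Lambda> \<C> \<longleftrightarrow> \<C> \<subseteq> mod_cat k \<Lambda> \<and> (\<exists>N\<in>\<C>. carrier N = {\<zero>\<^bsub>N\<^esub>}) \<and>
     (\<forall>X\<in>\<C>. \<forall>Z\<in>\<C>. \<forall>Y\<in>mod_cat k \<Lambda>. \<forall>u v. short_exact \<Lambda> X u Y v Z \<longrightarrow> Y \<in> \<C>)"

definition short_exact_in ::
  "('l, 'd) ring_scheme \<Rightarrow> ('l, 'm) module set \<Rightarrow> ('l, 'm) module \<Rightarrow> ('m \<Rightarrow> 'm) \<Rightarrow>
     ('l, 'm) module \<Rightarrow> ('m \<Rightarrow> 'm) \<Rightarrow> ('l, 'm) module \<Rightarrow> bool" where
  "short_exact_in \<Lambda> \<C> X u Y v Z \<longleftrightarrow> X \<in> \<C> \<and> Y \<in> \<C> \<and> Z \<in> \<C> \<and> short_exact \<Lambda> X u Y v Z"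

text \<open>Indecomposability is that of an object of \<open>\<C>\<close>: the summands are required to lie in \<open>\<C>\<close>.
  As \<open>\<C>\<close> is closed under isomorphism, internal direct sums suffice.\<close>

definition indecomposable_in ::
  "('l, 'd) ring_scheme \<Rightarrow> ('l, 'm) module set \<Rightarrow> ('l, 'm) module \<Rightarrow> bool" where
  "indecomposable_in \<Lambda> \<C> Z \<longleftrightarrow> Z \<in> \<C> \<and> carrier Z \<noteq> {\<zero>\<^bsub>Z\<^esub>} \<and>
     (\<forall>U V. submodule U \<Lambda> Z \<and> submodule V \<Lambda> Z \<and> Z\<lparr>carrier := U\<rparr> \<in> \<C> \<and> Z\<lparr>carrier := V\<rparr> \<in> \<C> \<and>
        U \<inter> V = {\<zero>\<^bsub>Z\<^esub>} \<and> U <+>\<^bsub>Z\<^esub> V = carrier Z \<longrightarrow> U = {\<zero>\<^bsub>Z\<^esub>} \<or> V = {\<zero>\<^bsub>Z\<^esub>})"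

definition projective_in ::
  "('l, 'd) ring_scheme \<Rightarrow> ('l, 'm) module set \<Rightarrow> ('l, 'm) module \<Rightarrow> bool" where
  "projective_in \<Lambda> \<C> P \<longleftrightarrow> P \<in> \<C> \<and>
     (\<forall>X u Y v Z. short_exact_in \<Lambda> \<C> X u Y v Z \<longrightarrow>
        (\<forall>h\<in>mod_hom \<Lambda> P Z. \<exists>h'\<in>mod_hom \<Lambda> P Y. compose (carrier P) v h' = h))"

definition left_almost_split ::
  "('l, 'd) ring_scheme \<Rightarrow> ('l, 'm) module set \<Rightarrow> ('l, 'm) module \<Rightarrow> ('l, 'm) module \<Rightarrow>
     ('m \<Rightarrow> 'm) \<Rightarrow> bool" where
  "left_almost_split \<Lambda> \<C> A B a \<longleftrightarrow> \<not> split_mono \<Lambda> A B a \<and>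
     (\<forall>N\<in>\<C>. \<forall>h\<in>mod_hom \<Lambda> A N. \<not> split_mono \<Lambda> A N h \<longrightarrow>
        (\<exists>h'\<in>mod_hom \<Lambda> B N. compose (carrier A) h' a = h))"

definition right_almost_split ::
  "('l, 'd) ring_scheme \<Rightarrow> ('l, 'm) module set \<Rightarrow> ('l, 'm) module \<Rightarrow> ('l, 'm) module \<Rightarrow>
     ('m \<Rightarrow> 'm) \<Rightarrow> bool" where
  "right_almost_split \<Lambda> \<C> B D b \<longleftrightarrow> \<not> split_epi \<Lambda> B D b \<and>
     (\<forall>N\<in>\<C>. \<forall>h\<in>mod_hom \<Lambda> N D. \<not> split_epi \<Lambda> N D h \<longrightarrow>
        (\<exists>h'\<in>mod_hom \<Lambda> N B. compose (carrier N) b h' = h))"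

definition AR_sequence ::
  "('l, 'd) ring_scheme \<Rightarrow> ('l, 'm) module set \<Rightarrow> ('l, 'm) module \<Rightarrow> ('m \<Rightarrow> 'm) \<Rightarrow>
     ('l, 'm) module \<Rightarrow> ('m \<Rightarrow> 'm) \<Rightarrow> ('l, 'm) module \<Rightarrow> bool" where
  "AR_sequence \<Lambda> \<C> A a B b D \<longleftrightarrow> short_exact_in \<Lambda> \<C> A a B b D \<and>
     left_almost_split \<Lambda> \<C> A B a \<and> right_almost_split \<Lambda> \<C> B D b"

text \<open>Only the existence of AR-sequences with prescribed end term is demanded; the dual condition,
  about sequences starting at a non-injective indecomposable object, is not needed to define \<open>\<tau>\<close>.\<close>

definition has_AR_sequences ::
  "('l, 'd) ring_scheme \<Rightarrow> ('l, 'm) module set \<Rightarrow> bool" where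
  "has_AR_sequences \<Lambda> \<C> \<longleftrightarrow>
     (\<forall>Z. indecomposable_in \<Lambda> \<C> Z \<and> \<not> projective_in \<Lambda> \<C> Z \<longrightarrow>
        (\<exists>A a B b. AR_sequence \<Lambda> \<C> A a B b Z))"

text \<open>The translate is determined up to isomorphism only; \<open>SOME\<close> selects a representative.\<close>

definition AR_translate ::
  "('l, 'd) ring_scheme \<Rightarrow> ('l, 'm) module set \<Rightarrow> ('l, 'm) module \<Rightarrow> ('l, 'm) module" where
  "AR_translate \<Lambda> \<C> Z = (SOME A. \<exists>a B b. AR_sequence \<Lambda> \<C> A a B b Z)"

section \<open>Cokernels of Hom maps and the composition form\<close>

text \<open>The abelian group \<open>Hom(M, N)\<close>. It is a \<open>monoid\<close> record, hence multiplicative notation: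
  \<open>\<otimes>\<close> is addition of homomorphisms and \<open>\<one>\<close> the zero homomorphism.\<close>

definition hom_group ::
  "('l, 'd) ring_scheme \<Rightarrow> ('l, 'm) module \<Rightarrow> ('l, 'm) module \<Rightarrow> ('m \<Rightarrow> 'm) monoid" where
  "hom_group \<Lambda> M N = \<lparr>carrier = mod_hom \<Lambda> M N,
     mult = (\<lambda>f g. \<lambda>x\<in>carrier M. f x \<oplus>\<^bsub>N\<^esub> g x), one = (\<lambda>x\<in>carrier M. \<zero>\<^bsub>N\<^esub>)\<rparr>"

definition hom_image ::
  "('l, 'd) ring_scheme \<Rightarrow> ('l, 'm) module \<Rightarrow> ('m \<Rightarrow> 'm) \<Rightarrow> ('l, 'm) module \<Rightarrow>
     ('l, 'm) module \<Rightarrow> ('m \<Rightarrow> 'm) set" where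
  "hom_image \<Lambda> X u Y M = (\<lambda>h. compose (carrier X) h u) ` mod_hom \<Lambda> Y M"

definition Cok ::
  "('l, 'd) ring_scheme \<Rightarrow> ('l, 'm) module \<Rightarrow> ('m \<Rightarrow> 'm) \<Rightarrow> ('l, 'm) module \<Rightarrow>
     ('l, 'm) module \<Rightarrow> ('m \<Rightarrow> 'm) set monoid" where
  "Cok \<Lambda> X u Y M = hom_group \<Lambda> X M Mod hom_image \<Lambda> X u Y M"

definition cok_class ::
  "('l, 'd) ring_scheme \<Rightarrow> ('l, 'm) module \<Rightarrow> ('m \<Rightarrow> 'm) \<Rightarrow> ('l, 'm) module \<Rightarrow>
     ('l, 'm) module \<Rightarrow> ('m \<Rightarrow> 'm) \<Rightarrow> ('m \<Rightarrow> 'm) set" where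
  "cok_class \<Lambda> X u Y M f = hom_image \<Lambda> X u Y M #>\<^bsub>hom_group \<Lambda> X M\<^esub> f"

text \<open>The form \<open>Hom(M, N) \<times> Cok(u, M) \<rightarrow> Cok(u, N)\<close>; the object \<open>M\<close> is implicit. For its
  independence of representatives and biadditivity see \<open>comp_form_class\<close> and
  \<open>comp_form_biadditive\<close> below.\<close>

definition comp_form ::
  "('l, 'd) ring_scheme \<Rightarrow> ('l, 'm) module \<Rightarrow> ('m \<Rightarrow> 'm) \<Rightarrow> ('l, 'm) module \<Rightarrow>
     ('l, 'm) module \<Rightarrow> ('m \<Rightarrow> 'm) \<Rightarrow> ('m \<Rightarrow> 'm) set \<Rightarrow> ('m \<Rightarrow> 'm) set" where
  "comp_form \<Lambda> X u Y N g F =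
     the_elem ((\<lambda>f. cok_class \<Lambda> X u Y N (compose (carrier X) g f)) ` F)"

lemma mod_homD:
  assumes "f \<in> mod_hom \<Lambda> M N"
  shows "x \<in> carrier M \<Longrightarrow> f x \<in> carrier N"
    and "x \<in> carrier M \<Longrightarrow> y \<in> carrier M \<Longrightarrow> f (x \<oplus>\<^bsub>M\<^esub> y) = f x \<oplus>\<^bsub>N\<^esub> f y"
    and "a \<in> carrier \<Lambda> \<Longrightarrow> x \<in> carrier M \<Longrightarrow> f (a \<odot>\<^bsub>M\<^esub> x) = a \<odot>\<^bsub>N\<^esub> f x"
    and "f \<in> extensional (carrier M)"
  using assms by (auto simp: mod_hom_def hom_def Pi_def)

lemma mod_homI:
  assumes "\<And>x. x \<in> carrier M \<Longrightarrow> f x \<in> carrier N"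
    and "\<And>x y. x \<in> carrier M \<Longrightarrow> y \<in> carrier M \<Longrightarrow> f (x \<oplus>\<^bsub>M\<^esub> y) = f x \<oplus>\<^bsub>N\<^esub> f y"
    and "\<And>a x. a \<in> carrier \<Lambda> \<Longrightarrow> x \<in> carrier M \<Longrightarrow> f (a \<odot>\<^bsub>M\<^esub> x) = a \<odot>\<^bsub>N\<^esub> f x"
    and "f \<in> extensional (carrier M)"
  shows "f \<in> mod_hom \<Lambda> M N"
  using assms by (auto simp: mod_hom_def hom_def Pi_def)

lemma mod_hom_compose:
  assumes "f \<in> mod_hom \<Lambda> L M" "g \<in> mod_hom \<Lambda> M N" "right_module \<Lambda> L"
  shows "compose (carrier L) g f \<in> mod_hom \<Lambda> L N"
proof -
  interpret L: right_module \<Lambda> L by fact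
  show ?thesis
    by (rule mod_homI)
      (auto simp: compose_def mod_homD[OF assms(1)] mod_homD[OF assms(2)] L.smult_closed)
qed

lemma comm_group_hom_group:
  assumes "right_module \<Lambda> M" "right_module \<Lambda> N"
  shows "comm_group (hom_group \<Lambda> M N)"
proof -
  interpret M: right_module \<Lambda> M by fact
  interpret N: right_module \<Lambda> N by fact
  have N0: "a \<odot>\<^bsub>N\<^esub> \<zero>\<^bsub>N\<^esub> = \<zero>\<^bsub>N\<^esub>" if "a \<in> carrier \<Lambda>" for a
    using N.smult_r_distr[OF that N.zero_closed N.zero_closed] N.smult_closed[OF that N.zero_closed]
    by (metis N.add.r_cancel_one' N.zero_closed N.r_zero)
  have Nneg: "a \<odot>\<^bsub>N\<^esub> (\<ominus>\<^bsub>N\<^esub> x) = \<ominus>\<^bsub>N\<^esub> (a \<odot>\<^bsub>N\<^esub> x)" if "a \<in> carrier \<Lambda>" "x \<in> carrier N" for a x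
    using N.smult_r_distr[of a x "\<ominus>\<^bsub>N\<^esub> x"] that N.smult_closed N0
    by (metis N.a_inv_closed N.minus_equality N.r_neg N.a_comm)
  show ?thesis
  proof (rule comm_groupI)
    fix f g assume f: "f \<in> carrier (hom_group \<Lambda> M N)" and g: "g \<in> carrier (hom_group \<Lambda> M N)"
    show "f \<otimes>\<^bsub>hom_group \<Lambda> M N\<^esub> g \<in> carrier (hom_group \<Lambda> M N)"
      using f g unfolding hom_group_def
      by (auto intro!: mod_homI simp: mod_homD M.smult_closed N.smult_r_distr N.a_ac)
    show "f \<otimes>\<^bsub>hom_group \<Lambda> M N\<^esub> g = g \<otimes>\<^bsub>hom_group \<Lambda> M N\<^esub> f"
      using f g unfolding hom_group_def
      by (auto intro!: restrict_ext simp: mod_homD N.a_comm)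
  next
    show "\<one>\<^bsub>hom_group \<Lambda> M N\<^esub> \<in> carrier (hom_group \<Lambda> M N)"
      unfolding hom_group_def by (auto intro!: mod_homI simp: M.smult_closed N0)
  next
    fix f g h assume "f \<in> carrier (hom_group \<Lambda> M N)" "g \<in> carrier (hom_group \<Lambda> M N)"
      "h \<in> carrier (hom_group \<Lambda> M N)"
    then show "f \<otimes>\<^bsub>hom_group \<Lambda> M N\<^esub> g \<otimes>\<^bsub>hom_group \<Lambda> M N\<^esub> h =
        f \<otimes>\<^bsub>hom_group \<Lambda> M N\<^esub> (g \<otimes>\<^bsub>hom_group \<Lambda> M N\<^esub> h)"
      unfolding hom_group_def by (auto intro!: restrict_ext simp: mod_homD N.a_assoc)
  next
    fix f assume f: "f \<in> carrier (hom_group \<Lambda> M N)"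
    then show "\<one>\<^bsub>hom_group \<Lambda> M N\<^esub> \<otimes>\<^bsub>hom_group \<Lambda> M N\<^esub> f = f"
      unfolding hom_group_def
      by (auto intro!: extensionalityI[where A = "carrier M"] simp: mod_homD)
    show "\<exists>g\<in>carrier (hom_group \<Lambda> M N). g \<otimes>\<^bsub>hom_group \<Lambda> M N\<^esub> f = \<one>\<^bsub>hom_group \<Lambda> M N\<^esub>"
      using f unfolding hom_group_def
      by (intro bexI[of _ "\<lambda>x\<in>carrier M. \<ominus>\<^bsub>N\<^esub> f x"])
        (auto intro!: mod_homI restrict_ext
          simp: mod_homD M.smult_closed N.l_neg N.minus_add Nneg)
  qed
qed

lemma subgroup_hom_image:
  assumes "right_module \<Lambda> X" "right_module \<Lambda> Y" "right_module \<Lambda> M" "u \<in> mod_hom \<Lambda> X Y"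
  shows "subgroup (hom_image \<Lambda> X u Y M) (hom_group \<Lambda> X M)"
proof -
  interpret X: comm_group "hom_group \<Lambda> X M" using assms comm_group_hom_group by blast
  interpret Y: comm_group "hom_group \<Lambda> Y M" using assms comm_group_hom_group by blast
  have "group_hom (hom_group \<Lambda> Y M) (hom_group \<Lambda> X M) (\<lambda>h. compose (carrier X) h u)"
    using mod_hom_compose[OF assms(4) _ assms(1)]
    by unfold_locales
      (auto simp: hom_def hom_group_def, auto simp: compose_def fun_eq_iff mod_homD(1)[OF assms(4)])
  from group_hom.img_is_subgroup[OF this] show ?thesis
    by (simp add: hom_image_def hom_group_def)
qed

lemma comp_form_class:
  assumes "right_module \<Lambda> X" "right_module \<Lambda> Y" "right_module \<Lambda> M" "right_module \<Lambda> N"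
    and u: "u \<in> mod_hom \<Lambda> X Y" and f: "f \<in> mod_hom \<Lambda> X M" and g: "g \<in> mod_hom \<Lambda> M N"
  shows "comp_form \<Lambda> X u Y N g (cok_class \<Lambda> X u Y M f) =
    cok_class \<Lambda> X u Y N (compose (carrier X) g f)"
proof -
  interpret N: comm_group "hom_group \<Lambda> X N" using assms comm_group_hom_group by blast
  have sN: "subgroup (hom_image \<Lambda> X u Y N) (hom_group \<Lambda> X N)"
    and sM: "subgroup (hom_image \<Lambda> X u Y M) (hom_group \<Lambda> X M)"
    using assms subgroup_hom_image by blast+
  have fM: "f \<in> carrier (hom_group \<Lambda> X M)" using f by (simp add: hom_group_def)
  have cM: "comm_group (hom_group \<Lambda> X M)" using assms comm_group_hom_group by blast
  have ff: "f \<in> cok_class \<Lambda> X u Y M f"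
    unfolding cok_class_def
    using group.rcos_self[OF comm_group.axioms(2)[OF cM] fM sM] .
  have eq: "cok_class \<Lambda> X u Y N (compose (carrier X) g f') =
      cok_class \<Lambda> X u Y N (compose (carrier X) g f)" if f': "f' \<in> cok_class \<Lambda> X u Y M f" for f'
  proof -
    from f' obtain h where h: "h \<in> mod_hom \<Lambda> Y M"
      and f'_eq: "f' = compose (carrier X) h u \<otimes>\<^bsub>hom_group \<Lambda> X M\<^esub> f"
      by (auto simp: cok_class_def r_coset_def hom_image_def)
    have gh: "compose (carrier Y) g h \<in> mod_hom \<Lambda> Y N"
      using mod_hom_compose assms h by blast
    have "compose (carrier X) g f' =
        compose (carrier X) (compose (carrier Y) g h) u \<otimes>\<^bsub>hom_group \<Lambda> X N\<^esub> compose (carrier X) g f"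
      unfolding f'_eq hom_group_def
      by (auto simp: compose_def fun_eq_iff mod_homD(1)[OF u] mod_homD(1)[OF h] mod_homD(1)[OF f]
          mod_homD(2)[OF g])
    then have "compose (carrier X) g f' \<in> hom_image \<Lambda> X u Y N #>\<^bsub>hom_group \<Lambda> X N\<^esub> compose (carrier X) g f"
      using gh by (auto simp: r_coset_def hom_image_def)
    moreover have "compose (carrier X) g f \<in> carrier (hom_group \<Lambda> X N)"
      using mod_hom_compose[OF f g] assms by (simp add: hom_group_def)
    ultimately show ?thesis
      unfolding cok_class_def using N.repr_independence[OF _ _ sN] by simp
  qed
  have "(\<lambda>f. cok_class \<Lambda> X u Y N (compose (carrier X) g f)) ` cok_class \<Lambda> X u Y M f =
      {cok_class \<Lambda> X u Y N (compose (carrier X) g f)}"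
    using ff eq by blast
  then show ?thesis by (simp add: comp_form_def)
qed

lemma cok_class_mult:
  assumes "right_module \<Lambda> X" "right_module \<Lambda> Y" "right_module \<Lambda> M" "u \<in> mod_hom \<Lambda> X Y"
    and "f \<in> mod_hom \<Lambda> X M" "f' \<in> mod_hom \<Lambda> X M"
  shows "cok_class \<Lambda> X u Y M f \<otimes>\<^bsub>Cok \<Lambda> X u Y M\<^esub> cok_class \<Lambda> X u Y M f' =
    cok_class \<Lambda> X u Y M (f \<otimes>\<^bsub>hom_group \<Lambda> X M\<^esub> f')"
proof -
  interpret comm_group "hom_group \<Lambda> X M" using assms comm_group_hom_group by blast
  interpret normal "hom_image \<Lambda> X u Y M" "hom_group \<Lambda> X M"
    using assms subgroup_hom_image subgroup_imp_normal by blast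
  show ?thesis
    using rcos_sum[of f f'] assms by (simp add: Cok_def FactGroup_def cok_class_def hom_group_def)
qed

lemma comp_form_biadditive:
  assumes "right_module \<Lambda> X" "right_module \<Lambda> Y" "right_module \<Lambda> M" "right_module \<Lambda> N"
    and u: "u \<in> mod_hom \<Lambda> X Y"
    and F: "F \<in> carrier (Cok \<Lambda> X u Y M)" "F' \<in> carrier (Cok \<Lambda> X u Y M)"
    and g: "g \<in> mod_hom \<Lambda> M N" "g' \<in> mod_hom \<Lambda> M N"
  shows "comp_form \<Lambda> X u Y N g (F \<otimes>\<^bsub>Cok \<Lambda> X u Y M\<^esub> F') =
      comp_form \<Lambda> X u Y N g F \<otimes>\<^bsub>Cok \<Lambda> X u Y N\<^esub> comp_form \<Lambda> X u Y N g F'"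
    and "comp_form \<Lambda> X u Y N (g \<otimes>\<^bsub>hom_group \<Lambda> M N\<^esub> g') F =
      comp_form \<Lambda> X u Y N g F \<otimes>\<^bsub>Cok \<Lambda> X u Y N\<^esub> comp_form \<Lambda> X u Y N g' F"
proof -
  obtain f f' where f: "f \<in> mod_hom \<Lambda> X M" "F = cok_class \<Lambda> X u Y M f"
    and f': "f' \<in> mod_hom \<Lambda> X M" "F' = cok_class \<Lambda> X u Y M f'"
    using F by (auto simp: Cok_def FactGroup_def RCOSETS_def cok_class_def hom_group_def)
  interpret XM: comm_group "hom_group \<Lambda> X M" using assms comm_group_hom_group by blast
  interpret MN: comm_group "hom_group \<Lambda> M N" using assms comm_group_hom_group by blast
  have ff': "f \<otimes>\<^bsub>hom_group \<Lambda> X M\<^esub> f' \<in> mod_hom \<Lambda> X M"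
    using XM.m_closed[of f f'] f f' by (simp add: hom_group_def)
  have gg': "g \<otimes>\<^bsub>hom_group \<Lambda> M N\<^esub> g' \<in> mod_hom \<Lambda> M N"
    using MN.m_closed[of g g'] g by (simp add: hom_group_def)
  note cls = comp_form_class[OF assms(1-4) u] cok_class_mult[OF assms(1,2) _ u] assms(3,4) f f' g
    ff' gg' mod_hom_compose[OF f(1) g(1) assms(1)] mod_hom_compose[OF f(1) g(2) assms(1)]
    mod_hom_compose[OF f'(1) g(1) assms(1)]
  have "compose (carrier X) g (f \<otimes>\<^bsub>hom_group \<Lambda> X M\<^esub> f') =
      compose (carrier X) g f \<otimes>\<^bsub>hom_group \<Lambda> X N\<^esub> compose (carrier X) g f'"
    by (auto simp: hom_group_def compose_def fun_eq_iff mod_homD[OF g(1)] mod_homD(1)[OF f(1)]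
        mod_homD(1)[OF f'(1)])
  then show "comp_form \<Lambda> X u Y N g (F \<otimes>\<^bsub>Cok \<Lambda> X u Y M\<^esub> F') =
      comp_form \<Lambda> X u Y N g F \<otimes>\<^bsub>Cok \<Lambda> X u Y N\<^esub> comp_form \<Lambda> X u Y N g F'"
    by (simp add: cls)
  have "compose (carrier X) (g \<otimes>\<^bsub>hom_group \<Lambda> M N\<^esub> g') f =
      compose (carrier X) g f \<otimes>\<^bsub>hom_group \<Lambda> X N\<^esub> compose (carrier X) g' f"
    by (auto simp: hom_group_def compose_def fun_eq_iff mod_homD(1)[OF f(1)])
  then show "comp_form \<Lambda> X u Y N (g \<otimes>\<^bsub>hom_group \<Lambda> M N\<^esub> g') F =
      comp_form \<Lambda> X u Y N g F \<otimes>\<^bsub>Cok \<Lambda> X u Y N\<^esub> comp_form \<Lambda> X u Y N g' F"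
    by (simp add: cls)
qed

end

theory Submission
  imports Defs
begin

text \<open>Let \<open>f : X \<rightarrow> M\<close> not factor through \<open>u\<close>, and let \<open>0 \<rightarrow> M \<rightarrow> W \<rightarrow> Z \<rightarrow> 0\<close> be the pushout of the
  given sequence along \<open>f\<close>. As \<open>f\<close> does not extend to \<open>Y\<close>, the map \<open>p : W \<rightarrow> Z\<close> is not a split
  epimorphism, so it lifts along the right almost split map \<open>b : B \<rightarrow> Z\<close> to some \<open>h : W \<rightarrow> B\<close>, which
  restricts to \<open>g : M \<rightarrow> \<tau>Z\<close> on kernels. If \<open>g f = s u\<close> for some \<open>s : Y \<rightarrow> \<tau>Z\<close>, then with
  \<open>j : Y \<rightarrow> W\<close> the pushout map and \<open>a : \<tau>Z \<rightarrow> B\<close> the inclusion, \<open>h j - a s\<close> kills \<open>u\<close> and hence factors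
  through \<open>v\<close> as a section of \<open>b\<close>, which is impossible.\<close>

section \<open>Module homomorphisms and the universal properties of a short exact sequence\<close>

text \<open>Viewing the action of a scalar as a group homomorphism supplies its compatibility with
  zero and negatives, which is not among the axioms of \<open>right_module\<close>.\<close>

lemma (in right_module) abelian_group_hom_smult:
  assumes "a \<in> carrier \<Lambda>"
  shows "abelian_group_hom M M (\<lambda>x. a \<odot>\<^bsub>M\<^esub> x)"
  using assms
  by (intro abelian_group_homI abelian_group_axioms)
    (auto simp: group_hom_def group_hom_axioms_def hom_def a_group smult_closed smult_r_distr)

lemma abelian_group_hom_mod_hom:
  assumes "right_module \<Lambda> M" "right_module \<Lambda> N" "f \<in> mod_hom \<Lambda> M N"
  shows "abelian_group_hom M N f"
proof -
  interpret M: right_module \<Lambda> M by fact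
  interpret N: right_module \<Lambda> N by fact
  show ?thesis
    using assms(3)
    by (intro abelian_group_homI M.abelian_group_axioms N.abelian_group_axioms)
      (auto simp: group_hom_def group_hom_axioms_def M.a_group N.a_group mod_hom_def)
qed

lemma mod_hom_diff:
  assumes "right_module \<Lambda> M" "right_module \<Lambda> N" "f \<in> mod_hom \<Lambda> M N" "g \<in> mod_hom \<Lambda> M N"
  shows "(\<lambda>x\<in>carrier M. f x \<ominus>\<^bsub>N\<^esub> g x) \<in> mod_hom \<Lambda> M N"
proof -
  interpret M: right_module \<Lambda> M by fact
  interpret N: right_module \<Lambda> N by fact
  have "a \<odot>\<^bsub>N\<^esub> (x \<ominus>\<^bsub>N\<^esub> y) = a \<odot>\<^bsub>N\<^esub> x \<ominus>\<^bsub>N\<^esub> a \<odot>\<^bsub>N\<^esub> y"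
    if "a \<in> carrier \<Lambda>" "x \<in> carrier N" "y \<in> carrier N" for a x y
    using that abelian_group_hom.hom_a_inv[OF N.abelian_group_hom_smult[OF that(1)] that(3)]
    by (simp add: N.minus_eq N.smult_r_distr)
  then show ?thesis
    by (intro mod_homI)
      (auto simp: mod_homD[OF assms(3)] mod_homD[OF assms(4)] M.smult_closed
        N.minus_eq N.minus_add N.a_ac)
qed

lemma short_exactD:
  assumes "short_exact \<Lambda> X u Y v Z"
  shows "u \<in> mod_hom \<Lambda> X Y" "v \<in> mod_hom \<Lambda> Y Z" "inj_on u (carrier X)"
    and "\<And>x. x \<in> carrier X \<Longrightarrow> v (u x) = \<zero>\<^bsub>Z\<^esub>"
    and "\<And>y. y \<in> carrier Y \<Longrightarrow> v y = \<zero>\<^bsub>Z\<^esub> \<Longrightarrow> \<exists>x\<in>carrier X. y = u x"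
    and "v ` carrier Y = carrier Z"
  using assms by (auto simp: short_exact_def kernel_def)

text \<open>The universal property of \<open>u\<close> as a kernel of \<open>v\<close>. Preimages
  under \<open>u\<close> are chosen pointwise; the choice is automatically linear because
  \<open>u\<close> is injective, so an identity in \<open>X\<close> may be checked after applying
  \<open>u\<close>.\<close>

lemma lift_through_kernel:
  assumes "right_module \<Lambda> X" "right_module \<Lambda> Y" "right_module \<Lambda> M"
    and ex: "short_exact \<Lambda> X u Y v Z" and \<phi>: "\<phi> \<in> mod_hom \<Lambda> M Y"
    and 0: "\<And>m. m \<in> carrier M \<Longrightarrow> v (\<phi> m) = \<zero>\<^bsub>Z\<^esub>"
  obtains g where "g \<in> mod_hom \<Lambda> M X" "\<And>m. m \<in> carrier M \<Longrightarrow> u (g m) = \<phi> m"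
proof -
  interpret X: right_module \<Lambda> X by fact
  interpret M: right_module \<Lambda> M by fact
  note u = short_exactD(1)[OF ex]
  have "\<forall>m\<in>carrier M. \<exists>x\<in>carrier X. u x = \<phi> m"
    using short_exactD(5)[OF ex] 0 mod_homD(1)[OF \<phi>] by metis
  then obtain g where g: "\<And>m. m \<in> carrier M \<Longrightarrow> g m \<in> carrier X"
    "\<And>m. m \<in> carrier M \<Longrightarrow> u (g m) = \<phi> m"
    by metis
  note inj = inj_onD[OF short_exactD(3)[OF ex]]
  have "g (x \<oplus>\<^bsub>M\<^esub> y) = g x \<oplus>\<^bsub>X\<^esub> g y" if "x \<in> carrier M" "y \<in> carrier M" for x y
    by (rule inj) (simp_all add: that g mod_homD[OF u] mod_homD[OF \<phi>])
  moreover have "g (a \<odot>\<^bsub>M\<^esub> x) = a \<odot>\<^bsub>X\<^esub> g x" if "a \<in> carrier \<Lambda>" "x \<in> carrier M" for a x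
    by (rule inj)
      (simp_all add: that g M.smult_closed X.smult_closed mod_homD[OF u] mod_homD[OF \<phi>])
  ultimately have "restrict g (carrier M) \<in> mod_hom \<Lambda> M X"
    by (intro mod_homI) (simp_all add: g M.smult_closed)
  then show thesis by (rule that) (simp add: g)
qed

text \<open>The universal property of \<open>v\<close> as a cokernel of \<open>u\<close>. Two
  preimages of the same element under \<open>v\<close> differ by an element of the image of
  \<open>u\<close>, where \<open>\<phi>\<close> vanishes; hence \<open>\<phi>\<close> evaluated at
  any preimage gives a well-defined map.\<close>

lemma descend_through_cokernel:
  assumes "right_module \<Lambda> Y" "right_module \<Lambda> Z" "right_module \<Lambda> N"
    and ex: "short_exact \<Lambda> X u Y v Z" and \<phi>: "\<phi> \<in> mod_hom \<Lambda> Y N"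
    and 0: "\<And>x. x \<in> carrier X \<Longrightarrow> \<phi> (u x) = \<zero>\<^bsub>N\<^esub>"
  obtains t where "t \<in> mod_hom \<Lambda> Z N" "\<And>y. y \<in> carrier Y \<Longrightarrow> t (v y) = \<phi> y"
proof -
  interpret Y: right_module \<Lambda> Y by fact
  interpret Z: right_module \<Lambda> Z by fact
  interpret N: right_module \<Lambda> N by fact
  note v = short_exactD(2)[OF ex] and surj = short_exactD(6)[OF ex]
  interpret v: abelian_group_hom Y Z v by (rule abelian_group_hom_mod_hom[OF assms(1,2) v])
  interpret \<phi>: abelian_group_hom Y N \<phi> by (rule abelian_group_hom_mod_hom[OF assms(1,3,5)])
  have wd: "\<phi> y = \<phi> y'" if y: "y \<in> carrier Y" "y' \<in> carrier Y" and "v y = v y'" for y y'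
  proof -
    have "v (y \<ominus>\<^bsub>Y\<^esub> y') = \<zero>\<^bsub>Z\<^esub>"
      using that by (simp add: Y.minus_eq Z.r_neg)
    then have "\<phi> (y \<ominus>\<^bsub>Y\<^esub> y') = \<zero>\<^bsub>N\<^esub>"
      using short_exactD(5)[OF ex, of "y \<ominus>\<^bsub>Y\<^esub> y'"] 0 y by auto
    \<comment> \<open>The leading zero is there to be replaced by the value of \<open>\<phi>\<close>
      at the difference of \<open>y\<close> and \<open>y'\<close>, which then cancels against
      \<open>\<phi> y'\<close>.\<close>
    then have "\<phi> y = \<zero>\<^bsub>N\<^esub> \<oplus>\<^bsub>N\<^esub> \<phi> y'"
      using y by (simp add: Y.minus_eq N.a_assoc N.l_neg flip: \<open>\<phi> (y \<ominus>\<^bsub>Y\<^esub> y') = \<zero>\<^bsub>N\<^esub>\<close>)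
    then show ?thesis using y by simp
  qed
  define t where "t = (\<lambda>z\<in>carrier Z. \<phi> (inv_into (carrier Y) v z))"
  have tv: "t (v y) = \<phi> y" if "y \<in> carrier Y" for y
    using that surj unfolding t_def
    by (auto intro!: wd simp: inv_into_into f_inv_into_f)
  have "t \<in> mod_hom \<Lambda> Z N"
  proof (rule mod_homI)
    fix z z' a assume "z \<in> carrier Z"
    then obtain y where y: "y \<in> carrier Y" "z = v y" using surj by auto
    show "t z \<in> carrier N" by (simp add: tv y)
    { assume "z' \<in> carrier Z"
      then obtain y' where y': "y' \<in> carrier Y" "z' = v y'" using surj by auto
      show "t (z \<oplus>\<^bsub>Z\<^esub> z') = t z \<oplus>\<^bsub>N\<^esub> t z'"
        using tv[of "y \<oplus>\<^bsub>Y\<^esub> y'"] y y' by (simp add: tv) }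
    { assume "a \<in> carrier \<Lambda>"
      then show "t (a \<odot>\<^bsub>Z\<^esub> z) = a \<odot>\<^bsub>N\<^esub> t z"
        using tv[of "a \<odot>\<^bsub>Y\<^esub> y"] y by (simp add: tv Y.smult_closed mod_homD[OF v] mod_homD[OF \<phi>]) }
  qed (simp add: t_def)
  then show thesis using tv by (rule that)
qed

section \<open>Products and quotients of modules, and the pushout\<close>

text \<open>For modules over \<open>'m\<close> the product lives on pairs, hence is not itself a
  candidate for an object of the subcategory; it only serves as the module of which the pushout is a
  quotient.\<close>

definition prod_module :: "('l, 'm) module \<Rightarrow> ('l, 'n) module \<Rightarrow> ('l, 'm \<times> 'n) module" where
  "prod_module M N = \<lparr>carrier = carrier M \<times> carrier N, mult = undefined, one = undefined,
     zero = (\<zero>\<^bsub>M\<^esub>, \<zero>\<^bsub>N\<^esub>), add = (\<lambda>p q. (fst p \<oplus>\<^bsub>M\<^esub> fst q, snd p \<oplus>\<^bsub>N\<^esub> snd q)),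
     smult = (\<lambda>a p. (a \<odot>\<^bsub>M\<^esub> fst p, a \<odot>\<^bsub>N\<^esub> snd p))\<rparr>"

lemma right_module_prod:
  assumes "right_module \<Lambda> M" "right_module \<Lambda> N"
  shows "right_module \<Lambda> (prod_module M N)"
proof -
  interpret M: right_module \<Lambda> M by fact
  interpret N: right_module \<Lambda> N by fact
  have "abelian_group (prod_module M N)"
  proof (rule abelian_groupI)
    fix p assume "p \<in> carrier (prod_module M N)"
    then show "\<exists>q\<in>carrier (prod_module M N). q \<oplus>\<^bsub>prod_module M N\<^esub> p = \<zero>\<^bsub>prod_module M N\<^esub>"
      by (intro bexI[of _ "(\<ominus>\<^bsub>M\<^esub> fst p, \<ominus>\<^bsub>N\<^esub> snd p)"])
        (auto simp: prod_module_def M.l_neg N.l_neg)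
  qed (auto simp: prod_module_def M.a_ac N.a_ac)
  then show ?thesis
    by (intro right_module.intro M.\<Lambda>.ring_axioms right_module_axioms.intro)
      (auto simp: prod_module_def M.smult_closed N.smult_closed M.smult_l_distr N.smult_l_distr
        M.smult_r_distr N.smult_r_distr M.smult_assoc N.smult_assoc M.smult_one N.smult_one)
qed

text \<open>Given a map \<open>\<psi>\<close> whose fibres form a congruence on \<open>P\<close>, this realises the quotient of \<open>P\<close> by that
  congruence on a type of one's choice; library quotients would live on sets of elements of \<open>P\<close>.\<close>

definition image_module :: "('l, 'p) module \<Rightarrow> ('p \<Rightarrow> 'm) \<Rightarrow> ('l, 'm) module" where
  "image_module P \<psi> = (let r = inv_into (carrier P) \<psi> in
     \<lparr>carrier = \<psi> ` carrier P, mult = undefined, one = undefined, zero = \<psi> \<zero>\<^bsub>P\<^esub>,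
      add = (\<lambda>x y. \<psi> (r x \<oplus>\<^bsub>P\<^esub> r y)), smult = (\<lambda>a x. \<psi> (a \<odot>\<^bsub>P\<^esub> r x))\<rparr>)"

lemma image_module_simps [simp]:
  "carrier (image_module P \<psi>) = \<psi> ` carrier P"
  "\<zero>\<^bsub>image_module P \<psi>\<^esub> = \<psi> \<zero>\<^bsub>P\<^esub>"
  by (simp_all add: image_module_def Let_def)

text \<open>By the two congruence hypotheses, the representatives picked by \<open>inv_into\<close>
  do not influence the result of an operation. So \<open>\<psi>\<close> respects the operations, and
  the module axioms pass from \<open>P\<close> to its image.\<close>

lemma image_module:
  assumes "right_module \<Lambda> P"
    and add: "\<And>p q p' q'. \<lbrakk>p \<in> carrier P; q \<in> carrier P; p' \<in> carrier P; q' \<in> carrier P;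
      \<psi> p = \<psi> p'; \<psi> q = \<psi> q'\<rbrakk> \<Longrightarrow> \<psi> (p \<oplus>\<^bsub>P\<^esub> q) = \<psi> (p' \<oplus>\<^bsub>P\<^esub> q')"
    and smult: "\<And>a p p'. \<lbrakk>a \<in> carrier \<Lambda>; p \<in> carrier P; p' \<in> carrier P; \<psi> p = \<psi> p'\<rbrakk> \<Longrightarrow>
      \<psi> (a \<odot>\<^bsub>P\<^esub> p) = \<psi> (a \<odot>\<^bsub>P\<^esub> p')"
  shows image_module_add: "\<And>p q. \<lbrakk>p \<in> carrier P; q \<in> carrier P\<rbrakk> \<Longrightarrow>
      \<psi> p \<oplus>\<^bsub>image_module P \<psi>\<^esub> \<psi> q = \<psi> (p \<oplus>\<^bsub>P\<^esub> q)"
    and image_module_smult: "\<And>a p. \<lbrakk>a \<in> carrier \<Lambda>; p \<in> carrier P\<rbrakk> \<Longrightarrow>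
      a \<odot>\<^bsub>image_module P \<psi>\<^esub> \<psi> p = \<psi> (a \<odot>\<^bsub>P\<^esub> p)"
    and right_module_image: "right_module \<Lambda> (image_module P \<psi>)"
proof -
  interpret P: right_module \<Lambda> P by fact
  show A: "\<psi> p \<oplus>\<^bsub>image_module P \<psi>\<^esub> \<psi> q = \<psi> (p \<oplus>\<^bsub>P\<^esub> q)"
    if "p \<in> carrier P" "q \<in> carrier P" for p q
    using that
    by (auto simp: image_module_def Let_def inv_into_into f_inv_into_f intro!: add)
  show S: "a \<odot>\<^bsub>image_module P \<psi>\<^esub> \<psi> p = \<psi> (a \<odot>\<^bsub>P\<^esub> p)"
    if "a \<in> carrier \<Lambda>" "p \<in> carrier P" for a p
    using that
    by (auto simp: image_module_def Let_def inv_into_into f_inv_into_f intro!: smult)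
  have "abelian_group (image_module P \<psi>)"
  proof (rule abelian_groupI)
    fix x assume "x \<in> carrier (image_module P \<psi>)"
    then obtain p where p: "p \<in> carrier P" "x = \<psi> p" by auto
    then show "\<exists>y\<in>carrier (image_module P \<psi>). y \<oplus>\<^bsub>image_module P \<psi>\<^esub> x = \<zero>\<^bsub>image_module P \<psi>\<^esub>"
      by (intro bexI[of _ "\<psi> (\<ominus>\<^bsub>P\<^esub> p)"]) (auto simp: A P.l_neg)
  qed (auto simp: A P.a_ac)
  then show "right_module \<Lambda> (image_module P \<psi>)"
    by (intro right_module.intro P.\<Lambda>.ring_axioms right_module_axioms.intro)
      (auto simp: A S P.smult_closed P.smult_l_distr P.smult_r_distr P.smult_assoc P.smult_one)
qed

text \<open>An infinite type is equipotent to its square, so pairs can be encoded injectively in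
  \<open>'m\<close>; \<open>\<psi>\<close> encodes a representative chosen from each class. This is
  what allows a quotient of a product to have its elements in \<open>'m\<close> again.\<close>

lemma ex_classifying_map:
  fixes E :: "('m \<times> 'm) rel"
  assumes "infinite (UNIV :: 'm set)" "equiv A E"
  obtains \<psi> :: "'m \<times> 'm \<Rightarrow> 'm" where "\<And>p q. p \<in> A \<Longrightarrow> q \<in> A \<Longrightarrow> \<psi> p = \<psi> q \<longleftrightarrow> (p, q) \<in> E"
proof -
  obtain e :: "'m \<times> 'm \<Rightarrow> 'm" where e: "inj e"
    using card_of_ordLeq[THEN iffD2, OF ordIso_imp_ordLeq[OF card_of_Times_same_infinite[OF assms(1)]]]
    by auto
  define \<psi> where "\<psi> p = e (SOME q. q \<in> E `` {p})" for p
  show thesis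
  proof (rule that)
    fix p q assume pq: "p \<in> A" "q \<in> A"
    have some: "(SOME q. q \<in> E `` {p}) \<in> E `` {p}" if "p \<in> A" for p
      by (rule someI, rule equiv_class_self[OF assms(2) that])
    show "\<psi> p = \<psi> q \<longleftrightarrow> (p, q) \<in> E"
    proof
      assume "\<psi> p = \<psi> q"
      then have "(SOME r. r \<in> E `` {p}) = (SOME r. r \<in> E `` {q})"
        using e by (simp add: \<psi>_def inj_eq)
      then show "(p, q) \<in> E"
        using some[OF pq(1)] some[OF pq(2)] equiv_class_nondisjoint[OF assms(2)] by (metis IntI empty_iff)
    next
      assume "(p, q) \<in> E"
      then have "E `` {p} = E `` {q}" by (rule equiv_class_eq[OF assms(2)])
      then show "\<psi> p = \<psi> q" by (simp add: \<psi>_def)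
    qed
  qed
qed

text \<open>The module \<open>W\<close> is the quotient of the product of \<open>M\<close> and
  \<open>Y\<close> by the submodule of all pairs \<open>(f x, - u x)\<close>. The last clause, that
  \<open>i\<close> and \<open>j\<close> together generate \<open>W\<close>, is what later bounds its
  dimension.\<close>

lemma pushout:
  fixes X Y Z M :: "('l, 'm) module"
  assumes inf: "infinite (UNIV :: 'm set)"
    and rm: "right_module \<Lambda> X" "right_module \<Lambda> Y" "right_module \<Lambda> Z" "right_module \<Lambda> M"
    and ex: "short_exact \<Lambda> X u Y v Z" and f: "f \<in> mod_hom \<Lambda> X M"
  obtains W :: "('l, 'm) module" and i j p where "right_module \<Lambda> W"
    "short_exact \<Lambda> M i W p Z" "j \<in> mod_hom \<Lambda> Y W"
    "\<And>x. x \<in> carrier X \<Longrightarrow> j (u x) = i (f x)"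
    "\<And>y. y \<in> carrier Y \<Longrightarrow> p (j y) = v y"
    "\<And>w. w \<in> carrier W \<Longrightarrow> \<exists>m\<in>carrier M. \<exists>y\<in>carrier Y. w = i m \<oplus>\<^bsub>W\<^esub> j y"
proof -
  interpret X: right_module \<Lambda> X by fact
  interpret Y: right_module \<Lambda> Y by fact
  interpret Z: right_module \<Lambda> Z by fact
  interpret M: right_module \<Lambda> M by fact
  note u = short_exactD(1)[OF ex] and v = short_exactD(2)[OF ex]
  interpret u: abelian_group_hom X Y u by (rule abelian_group_hom_mod_hom[OF rm(1,2) u])
  interpret v: abelian_group_hom Y Z v by (rule abelian_group_hom_mod_hom[OF rm(2,3) v])
  interpret f: abelian_group_hom X M f by (rule abelian_group_hom_mod_hom[OF rm(1,4) f])
  let ?P = "prod_module M Y"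
  interpret P: right_module \<Lambda> ?P by (rule right_module_prod[OF rm(4,2)])
  have P: "carrier ?P = carrier M \<times> carrier Y" "\<zero>\<^bsub>?P\<^esub> = (\<zero>\<^bsub>M\<^esub>, \<zero>\<^bsub>Y\<^esub>)"
    "(m, y) \<oplus>\<^bsub>?P\<^esub> (m', y') = (m \<oplus>\<^bsub>M\<^esub> m', y \<oplus>\<^bsub>Y\<^esub> y')" "a \<odot>\<^bsub>?P\<^esub> (m, y) = (a \<odot>\<^bsub>M\<^esub> m, a \<odot>\<^bsub>Y\<^esub> y)"
    for m y m' y' a
    by (simp_all add: prod_module_def)
  \<comment> \<open>Congruence modulo the pairs \<open>(f x, - u x)\<close>, written without
    subtraction by moving \<open>u x\<close> to the other side.\<close>
  define E where "E = {((m, y), (m', y')) | m y m' y'. m \<in> carrier M \<and> m' \<in> carrier M \<and>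
    y \<in> carrier Y \<and> y' \<in> carrier Y \<and> (\<exists>x\<in>carrier X. m' = m \<oplus>\<^bsub>M\<^esub> f x \<and> y = y' \<oplus>\<^bsub>Y\<^esub> u x)}"
  have E: "((m, y), (m', y')) \<in> E \<longleftrightarrow> m \<in> carrier M \<and> m' \<in> carrier M \<and>
    y \<in> carrier Y \<and> y' \<in> carrier Y \<and> (\<exists>x\<in>carrier X. m' = m \<oplus>\<^bsub>M\<^esub> f x \<and> y = y' \<oplus>\<^bsub>Y\<^esub> u x)"
    for m y m' y'
    by (simp add: E_def)
  have "equiv (carrier M \<times> carrier Y) E"
  proof (rule equivI)
    show "E \<subseteq> (carrier M \<times> carrier Y) \<times> (carrier M \<times> carrier Y)" by (auto simp: E_def)
    show "refl_on (carrier M \<times> carrier Y) E"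
      by (rule refl_onI) (auto simp: E intro!: bexI[of _ "\<zero>\<^bsub>X\<^esub>"])
    show "sym E"
    proof (rule symI, clarify)
      fix m y m' y' assume "((m, y), (m', y')) \<in> E"
      then show "((m', y'), (m, y)) \<in> E"
        by (auto simp: E M.a_assoc Y.a_assoc M.r_neg Y.r_neg intro!: bexI[of _ "\<ominus>\<^bsub>X\<^esub> _"])
    qed
    show "trans E"
    proof (rule transI, clarify)
      fix m y m' y' m'' y'' assume "((m, y), (m', y')) \<in> E" "((m', y'), (m'', y'')) \<in> E"
      then obtain x x' where "x \<in> carrier X" "m' = m \<oplus>\<^bsub>M\<^esub> f x" "y = y' \<oplus>\<^bsub>Y\<^esub> u x"
        "x' \<in> carrier X" "m'' = m' \<oplus>\<^bsub>M\<^esub> f x'" "y' = y'' \<oplus>\<^bsub>Y\<^esub> u x'"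
        "m \<in> carrier M" "y'' \<in> carrier Y"
        by (auto simp: E)
      then show "((m, y), (m'', y'')) \<in> E"
        by (auto simp: E M.a_ac Y.a_ac intro!: bexI[of _ "x \<oplus>\<^bsub>X\<^esub> x'"])
    qed
  qed
  then obtain \<psi> :: "'m \<times> 'm \<Rightarrow> 'm" where
    "\<And>p q. p \<in> carrier M \<times> carrier Y \<Longrightarrow> q \<in> carrier M \<times> carrier Y \<Longrightarrow> \<psi> p = \<psi> q \<longleftrightarrow> (p, q) \<in> E"
    using ex_classifying_map[OF inf] by metis
  then have \<psi>: "\<psi> (m, y) = \<psi> (m', y') \<longleftrightarrow> (\<exists>x\<in>carrier X. m' = m \<oplus>\<^bsub>M\<^esub> f x \<and> y = y' \<oplus>\<^bsub>Y\<^esub> u x)"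
    if "m \<in> carrier M" "y \<in> carrier Y" "m' \<in> carrier M" "y' \<in> carrier Y" for m y m' y'
    using that by (simp add: E)
  define W where "W = image_module ?P \<psi>"
  have add: "\<psi> (p \<oplus>\<^bsub>?P\<^esub> q) = \<psi> (p' \<oplus>\<^bsub>?P\<^esub> q')"
    if pq: "p \<in> carrier ?P" "q \<in> carrier ?P" "p' \<in> carrier ?P" "q' \<in> carrier ?P"
      and eq: "\<psi> p = \<psi> p'" "\<psi> q = \<psi> q'" for p q p' q'
  proof -
    obtain m y m' y' where p: "p = (m, y)" "p' = (m', y')"
      "m \<in> carrier M" "y \<in> carrier Y" "m' \<in> carrier M" "y' \<in> carrier Y"
      using pq by (auto simp: P)
    obtain n z n' z' where q: "q = (n, z)" "q' = (n', z')"
      "n \<in> carrier M" "z \<in> carrier Y" "n' \<in> carrier M" "z' \<in> carrier Y"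
      using pq by (auto simp: P)
    obtain x x' where "x \<in> carrier X" "m' = m \<oplus>\<^bsub>M\<^esub> f x" "y = y' \<oplus>\<^bsub>Y\<^esub> u x"
      "x' \<in> carrier X" "n' = n \<oplus>\<^bsub>M\<^esub> f x'" "z = z' \<oplus>\<^bsub>Y\<^esub> u x'"
      using eq p q by (auto simp: \<psi>)
    then show ?thesis
      using p q by (auto simp: P \<psi> M.a_ac Y.a_ac intro!: bexI[of _ "x \<oplus>\<^bsub>X\<^esub> x'"])
  qed
  have smult: "\<psi> (a \<odot>\<^bsub>?P\<^esub> p) = \<psi> (a \<odot>\<^bsub>?P\<^esub> p')"
    if pq: "a \<in> carrier \<Lambda>" "p \<in> carrier ?P" "p' \<in> carrier ?P" and eq: "\<psi> p = \<psi> p'" for a p p'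
  proof -
    obtain m y m' y' where p: "p = (m, y)" "p' = (m', y')"
      "m \<in> carrier M" "y \<in> carrier Y" "m' \<in> carrier M" "y' \<in> carrier Y"
      using pq by (auto simp: P)
    obtain x where "x \<in> carrier X" "m' = m \<oplus>\<^bsub>M\<^esub> f x" "y = y' \<oplus>\<^bsub>Y\<^esub> u x"
      using eq p by (auto simp: \<psi>)
    then show ?thesis
      using p pq(1)
      by (auto simp: P \<psi> M.smult_closed Y.smult_closed X.smult_closed M.smult_r_distr
          Y.smult_r_distr mod_homD[OF u] mod_homD[OF f] intro!: bexI[of _ "a \<odot>\<^bsub>X\<^esub> x"])
  qed
  note image = image_module[OF P.right_module_axioms add smult, folded W_def]
  interpret W: right_module \<Lambda> W by (rule image)
  have W: "carrier W = \<psi> ` (carrier M \<times> carrier Y)" "\<zero>\<^bsub>W\<^esub> = \<psi> (\<zero>\<^bsub>M\<^esub>, \<zero>\<^bsub>Y\<^esub>)"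
    by (simp_all add: W_def P)
  have W_add: "\<psi> (m, y) \<oplus>\<^bsub>W\<^esub> \<psi> (m', y') = \<psi> (m \<oplus>\<^bsub>M\<^esub> m', y \<oplus>\<^bsub>Y\<^esub> y')"
    if "m \<in> carrier M" "y \<in> carrier Y" "m' \<in> carrier M" "y' \<in> carrier Y" for m y m' y'
    unfolding P(3)[symmetric] by (rule image(1)) (use that in \<open>simp_all add: P(1)\<close>)
  have W_smult: "a \<odot>\<^bsub>W\<^esub> \<psi> (m, y) = \<psi> (a \<odot>\<^bsub>M\<^esub> m, a \<odot>\<^bsub>Y\<^esub> y)"
    if "a \<in> carrier \<Lambda>" "m \<in> carrier M" "y \<in> carrier Y" for a m y
    unfolding P(4)[symmetric] by (rule image(2)) (use that in \<open>simp_all add: P(1)\<close>)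
  have M0: "a \<odot>\<^bsub>M\<^esub> \<zero>\<^bsub>M\<^esub> = \<zero>\<^bsub>M\<^esub>" and Y0: "a \<odot>\<^bsub>Y\<^esub> \<zero>\<^bsub>Y\<^esub> = \<zero>\<^bsub>Y\<^esub>" if "a \<in> carrier \<Lambda>" for a
    using that abelian_group_hom.hom_zero[OF M.abelian_group_hom_smult]
      abelian_group_hom.hom_zero[OF Y.abelian_group_hom_smult] by auto
  define i where "i = (\<lambda>m\<in>carrier M. \<psi> (m, \<zero>\<^bsub>Y\<^esub>))"
  define j where "j = (\<lambda>y\<in>carrier Y. \<psi> (\<zero>\<^bsub>M\<^esub>, y))"
  \<comment> \<open>The map induced by zero on \<open>M\<close> and \<open>v\<close> on
    \<open>Y\<close>. The chosen representative does not matter, since changing it alters the second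
    component by some \<open>u x\<close>, and \<open>v\<close> kills it.\<close>
  define p where "p = (\<lambda>w\<in>carrier W. v (snd (inv_into (carrier M \<times> carrier Y) \<psi> w)))"
  have p: "p (\<psi> (m, y)) = v y" if my: "m \<in> carrier M" "y \<in> carrier Y" for m y
  proof -
    obtain m' y' where r: "inv_into (carrier M \<times> carrier Y) \<psi> (\<psi> (m, y)) = (m', y')" by fastforce
    have "(m', y') \<in> carrier M \<times> carrier Y" "\<psi> (m', y') = \<psi> (m, y)"
      using my inv_into_into[of "\<psi> (m, y)" \<psi> "carrier M \<times> carrier Y"]
        f_inv_into_f[of "\<psi> (m, y)" \<psi> "carrier M \<times> carrier Y"]
      unfolding r[symmetric] by blast+
    then show ?thesis
      using my r by (auto simp: p_def W \<psi> short_exactD(4)[OF ex])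
  qed
  have i: "i \<in> mod_hom \<Lambda> M W"
    by (rule mod_homI) (auto simp: i_def W W_add W_smult M.smult_closed Y0)
  have j: "j \<in> mod_hom \<Lambda> Y W"
    by (rule mod_homI) (auto simp: j_def W W_add W_smult Y.smult_closed M0)
  have p_hom: "p \<in> mod_hom \<Lambda> W Z"
  proof (rule mod_homI)
    show "p \<in> extensional (carrier W)" by (simp add: p_def)
  qed (auto simp: W W_add W_smult p M.smult_closed Y.smult_closed mod_homD[OF v])
  \<comment> \<open>If \<open>i\<close> identifies two elements, they differ by \<open>f x\<close>
    for some \<open>x\<close> with \<open>u x\<close> zero; injectivity of \<open>u\<close> then
    makes \<open>x\<close> zero.\<close>
  have "inj_on i (carrier M)"
  proof (rule inj_onI)
    fix m m' assume m: "m \<in> carrier M" "m' \<in> carrier M" "i m = i m'"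
    then obtain x where x: "x \<in> carrier X" "m' = m \<oplus>\<^bsub>M\<^esub> f x" "\<zero>\<^bsub>Y\<^esub> = u x"
      by (auto simp: i_def \<psi>)
    then have "x = \<zero>\<^bsub>X\<^esub>" using inj_onD[OF short_exactD(3)[OF ex], of x "\<zero>\<^bsub>X\<^esub>"] by simp
    then show "m = m'" using x m by simp
  qed
  moreover have "i ` carrier M = kernel (add_monoid W) (add_monoid Z) p"
  proof
    show "i ` carrier M \<subseteq> kernel (add_monoid W) (add_monoid Z) p"
      by (auto simp: i_def kernel_def W p)
    show "kernel (add_monoid W) (add_monoid Z) p \<subseteq> i ` carrier M"
    proof
      fix w assume "w \<in> kernel (add_monoid W) (add_monoid Z) p"
      then obtain m y where my: "m \<in> carrier M" "y \<in> carrier Y" "w = \<psi> (m, y)" "v y = \<zero>\<^bsub>Z\<^esub>"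
        by (auto simp: kernel_def W p)
      then obtain x where "x \<in> carrier X" "y = u x" using short_exactD(5)[OF ex] by blast
      \<comment> \<open>The relation trades the second component \<open>u x\<close> for the summand
        \<open>f x\<close> in the first, so the class has a representative in
        \<open>M\<close>.\<close>
      then have "\<psi> (m, y) = i (m \<oplus>\<^bsub>M\<^esub> f x)" using my by (auto simp: i_def \<psi>)
      then show "w \<in> i ` carrier M" using my \<open>x \<in> carrier X\<close> by auto
    qed
  qed
  moreover have "p ` carrier W = carrier Z"
  proof
    show "p ` carrier W \<subseteq> carrier Z" using mod_homD(1)[OF p_hom] by blast
    show "carrier Z \<subseteq> p ` carrier W"
    proof
      fix z assume "z \<in> carrier Z"
      then obtain y where "y \<in> carrier Y" "z = v y" using short_exactD(6)[OF ex] by blast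
      then have "z = p (\<psi> (\<zero>\<^bsub>M\<^esub>, y))" "\<psi> (\<zero>\<^bsub>M\<^esub>, y) \<in> carrier W" by (auto simp: p W)
      then show "z \<in> p ` carrier W" by blast
    qed
  qed
  ultimately have "short_exact \<Lambda> M i W p Z"
    using i p_hom by (simp add: short_exact_def)
  moreover have "j (u x) = i (f x)" if "x \<in> carrier X" for x
    using that by (auto simp: i_def j_def \<psi>)
  moreover have "p (j y) = v y" if "y \<in> carrier Y" for y
    using that by (simp add: j_def p)
  moreover have "\<exists>m\<in>carrier M. \<exists>y\<in>carrier Y. w = i m \<oplus>\<^bsub>W\<^esub> j y" if w: "w \<in> carrier W" for w
  proof -
    obtain m y where "m \<in> carrier M" "y \<in> carrier Y" "w = \<psi> (m, y)"
      using w by (auto simp: W)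
    then have "w = i m \<oplus>\<^bsub>W\<^esub> j y"
      by (simp add: i_def j_def W_add)
    with \<open>m \<in> carrier M\<close> \<open>y \<in> carrier Y\<close> show ?thesis by blast
  qed
  ultimately show thesis using that[OF W.right_module_axioms _ j] by blast
qed

section \<open>Spanning sets and finite dimension of the pushout\<close>

definition lin_combs :: "('k, 'c) ring_scheme \<Rightarrow> ('k, 'v, 'd) module_scheme \<Rightarrow> 'v set \<Rightarrow> 'v set" where
  "lin_combs k V B = {\<Oplus>\<^bsub>V\<^esub>b\<in>B. c b \<odot>\<^bsub>V\<^esub> b | c. c \<in> B \<rightarrow> carrier k}"

lemma fin_dim_iff:
  "fin_dim k V \<longleftrightarrow> (\<exists>B. finite B \<and> B \<subseteq> carrier V \<and> carrier V \<subseteq> lin_combs k V B)"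
  unfolding fin_dim_def lin_combs_def subset_iff Ball_def Bex_def mem_Collect_eq
  by (simp add: conj_commute)

context module
begin

text \<open>With these closure properties the later arguments about spans can avoid explicit
  coefficient families. In the last part, a coefficient family that is one at \<open>b\<close> and
  zero elsewhere recovers \<open>b\<close>.\<close>

lemma lin_combs_closed:
  assumes B: "finite B" "B \<subseteq> carrier M"
  shows "\<zero>\<^bsub>M\<^esub> \<in> lin_combs R M B"
    and "x \<in> lin_combs R M B \<Longrightarrow> y \<in> lin_combs R M B \<Longrightarrow> x \<oplus>\<^bsub>M\<^esub> y \<in> lin_combs R M B"
    and "a \<in> carrier R \<Longrightarrow> x \<in> lin_combs R M B \<Longrightarrow> a \<odot>\<^bsub>M\<^esub> x \<in> lin_combs R M B"
    and "B \<subseteq> lin_combs R M B"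
proof -
  have cl: "(\<lambda>b. c b \<odot>\<^bsub>M\<^esub> b) \<in> B \<rightarrow> carrier M" if "c \<in> B \<rightarrow> carrier R" for c
    using that B by auto
  show "\<zero>\<^bsub>M\<^esub> \<in> lin_combs R M B"
    using B unfolding lin_combs_def
    by (auto intro!: exI[of _ "\<lambda>_. \<zero>"] M.add.finprod_one_eqI[symmetric] simp: subset_iff)
  show "x \<oplus>\<^bsub>M\<^esub> y \<in> lin_combs R M B" if xy: "x \<in> lin_combs R M B" "y \<in> lin_combs R M B"
  proof -
    obtain c d where c: "c \<in> B \<rightarrow> carrier R" "x = (\<Oplus>\<^bsub>M\<^esub>b\<in>B. c b \<odot>\<^bsub>M\<^esub> b)"
      and d: "d \<in> B \<rightarrow> carrier R" "y = (\<Oplus>\<^bsub>M\<^esub>b\<in>B. d b \<odot>\<^bsub>M\<^esub> b)"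
      using xy by (auto simp: lin_combs_def)
    have "x \<oplus>\<^bsub>M\<^esub> y = (\<Oplus>\<^bsub>M\<^esub>b\<in>B. c b \<odot>\<^bsub>M\<^esub> b \<oplus>\<^bsub>M\<^esub> d b \<odot>\<^bsub>M\<^esub> b)"
      using M.finsum_addf[OF cl[OF c(1)] cl[OF d(1)]] c d by simp
    also have "\<dots> = (\<Oplus>\<^bsub>M\<^esub>b\<in>B. (c b \<oplus> d b) \<odot>\<^bsub>M\<^esub> b)"
      using B c d by (intro M.finsum_cong') (auto simp: smult_l_distr subset_iff Pi_iff)
    finally show ?thesis
      unfolding lin_combs_def using c d by (auto intro!: exI[of _ "\<lambda>b. c b \<oplus> d b"])
  qed
  show "a \<odot>\<^bsub>M\<^esub> x \<in> lin_combs R M B" if a: "a \<in> carrier R" and x: "x \<in> lin_combs R M B"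
  proof -
    obtain c where c: "c \<in> B \<rightarrow> carrier R" "x = (\<Oplus>\<^bsub>M\<^esub>b\<in>B. c b \<odot>\<^bsub>M\<^esub> b)"
      using x by (auto simp: lin_combs_def)
    have "a \<odot>\<^bsub>M\<^esub> x = (\<Oplus>\<^bsub>M\<^esub>b\<in>B. a \<odot>\<^bsub>M\<^esub> (c b \<odot>\<^bsub>M\<^esub> b))"
      using finsum_smult_ldistr[OF B(1) a cl[OF c(1)]] c by simp
    also have "\<dots> = (\<Oplus>\<^bsub>M\<^esub>b\<in>B. (a \<otimes> c b) \<odot>\<^bsub>M\<^esub> b)"
      using B c a by (intro M.finsum_cong') (auto simp: smult_assoc1 subset_iff Pi_iff)
    finally show ?thesis
      unfolding lin_combs_def using c a by (auto intro!: exI[of _ "\<lambda>b. a \<otimes> c b"])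
  qed
  show "B \<subseteq> lin_combs R M B"
  proof
    fix b assume b: "b \<in> B"
    have "(\<Oplus>\<^bsub>M\<^esub>b'\<in>B. (if b = b' then \<one> else \<zero>) \<odot>\<^bsub>M\<^esub> b') = (\<Oplus>\<^bsub>M\<^esub>b'\<in>B. if b = b' then b' else \<zero>\<^bsub>M\<^esub>)"
      using B by (intro M.finsum_cong') (auto simp: subset_iff)
    also have "\<dots> = b"
      using B b by (intro M.finsum_singleton) auto
    finally show "b \<in> lin_combs R M B"
      unfolding lin_combs_def by (auto intro!: exI[of _ "\<lambda>b'. if b = b' then \<one> else \<zero>"])
  qed
qed

text \<open>Induction over the finite subsets of \<open>B\<close> needs only the closure properties
  of the target span; there is no need to collect coefficients of elements that
  \<open>\<phi>\<close> identifies. Allowing \<open>B'\<close> to be larger than the image of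
  \<open>B\<close> puts the images of several maps into one span.\<close>

lemma linear_image_lin_combs:
  assumes "module R N" and B: "finite B" "B \<subseteq> carrier M" and B': "finite B'" "B' \<subseteq> carrier N"
    and hom: "abelian_group_hom M N \<phi>"
    and lin: "\<And>a x. a \<in> carrier R \<Longrightarrow> x \<in> carrier M \<Longrightarrow> \<phi> (a \<odot>\<^bsub>M\<^esub> x) = a \<odot>\<^bsub>N\<^esub> \<phi> x"
    and sub: "\<phi> ` B \<subseteq> B'"
  shows "\<phi> ` lin_combs R M B \<subseteq> lin_combs R N B'"
proof (clarsimp simp: lin_combs_def[of R M])
  interpret N: module R N by fact
  interpret \<phi>: abelian_group_hom M N \<phi> by fact
  note cl = N.lin_combs_closed[OF B']
  fix c assume c: "c \<in> B \<rightarrow> carrier R"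
  have "\<phi> (\<Oplus>\<^bsub>M\<^esub>b\<in>F. c b \<odot>\<^bsub>M\<^esub> b) \<in> lin_combs R N B'" if "finite F" "F \<subseteq> B" for F
    using that
  proof (induction F rule: finite_induct)
    case (insert b F)
    then have "(\<Oplus>\<^bsub>M\<^esub>b\<in>insert b F. c b \<odot>\<^bsub>M\<^esub> b) = c b \<odot>\<^bsub>M\<^esub> b \<oplus>\<^bsub>M\<^esub> (\<Oplus>\<^bsub>M\<^esub>b\<in>F. c b \<odot>\<^bsub>M\<^esub> b)"
      using B c by (intro M.finsum_insert) auto
    moreover have "(\<Oplus>\<^bsub>M\<^esub>b\<in>F. c b \<odot>\<^bsub>M\<^esub> b) \<in> carrier M"
      using insert B c by (intro M.finsum_closed) auto
    ultimately show ?case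
      using insert B c sub cl by (auto simp: lin subset_iff Pi_iff)
  qed (simp add: cl)
  then show "\<phi> (\<Oplus>\<^bsub>M\<^esub>b\<in>B. c b \<odot>\<^bsub>M\<^esub> b) \<in> lin_combs R N B'" using B by simp
qed

end

lemma underlying_space_simps [simp]:
  "carrier (underlying_space \<Lambda> M) = carrier M" "\<zero>\<^bsub>underlying_space \<Lambda> M\<^esub> = \<zero>\<^bsub>M\<^esub>"
  "x \<oplus>\<^bsub>underlying_space \<Lambda> M\<^esub> y = x \<oplus>\<^bsub>M\<^esub> y"
  "c \<odot>\<^bsub>underlying_space \<Lambda> M\<^esub> x = (c \<odot>\<^bsub>\<Lambda>\<^esub> \<one>\<^bsub>\<Lambda>\<^esub>) \<odot>\<^bsub>M\<^esub> x"
  by (simp_all add: underlying_space_def)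

lemma module_underlying_space:
  assumes "fd_algebra k \<Lambda>" "right_module \<Lambda> M"
  shows "module k (underlying_space \<Lambda> M)"
proof -
  interpret fd_algebra k \<Lambda> by fact
  interpret M: right_module \<Lambda> M by fact
  show ?thesis
  proof (rule moduleI)
    show "cring k" by (rule module.axioms(1)[OF module_axioms])
    show "abelian_group (underlying_space \<Lambda> M)"
      by (rule abelian_groupI) (auto simp: M.a_ac intro: M.l_neg M.a_inv_closed)
  next
    fix a b x assume a: "a \<in> carrier k" "b \<in> carrier k" and x: "x \<in> carrier (underlying_space \<Lambda> M)"
    \<comment> \<open>The factors are put in reverse order because \<open>smult_assoc\<close> lets
      the left factor of a product act first, whereas \<open>a\<close> has to act last here.\<close>
    have "(a \<otimes>\<^bsub>k\<^esub> b) \<odot>\<^bsub>\<Lambda>\<^esub> \<one>\<^bsub>\<Lambda>\<^esub> = (b \<odot>\<^bsub>\<Lambda>\<^esub> \<one>\<^bsub>\<Lambda>\<^esub>) \<otimes>\<^bsub>\<Lambda>\<^esub> (a \<odot>\<^bsub>\<Lambda>\<^esub> \<one>\<^bsub>\<Lambda>\<^esub>)"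
      using a by (simp add: smult_mult_right smult_assoc1)
    then show "(a \<otimes>\<^bsub>k\<^esub> b) \<odot>\<^bsub>underlying_space \<Lambda> M\<^esub> x =
        a \<odot>\<^bsub>underlying_space \<Lambda> M\<^esub> (b \<odot>\<^bsub>underlying_space \<Lambda> M\<^esub> x)"
      using a x by (simp add: M.smult_assoc)
  qed (auto simp: M.smult_closed M.smult_l_distr M.smult_r_distr M.smult_one smult_l_distr)
qed

text \<open>The images under \<open>i\<close> and \<open>j\<close> of finite spanning sets of
  \<open>M\<close> and \<open>Y\<close> together span \<open>W\<close>.\<close>

lemma fin_dim_sum:
  assumes k: "fd_algebra k \<Lambda>" and rm: "right_module \<Lambda> M" "right_module \<Lambda> Y" "right_module \<Lambda> W"
    and fd: "fin_dim k (underlying_space \<Lambda> M)" "fin_dim k (underlying_space \<Lambda> Y)"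
    and i: "i \<in> mod_hom \<Lambda> M W" and j: "j \<in> mod_hom \<Lambda> Y W"
    and W: "\<And>w. w \<in> carrier W \<Longrightarrow> \<exists>m\<in>carrier M. \<exists>y\<in>carrier Y. w = i m \<oplus>\<^bsub>W\<^esub> j y"
  shows "fin_dim k (underlying_space \<Lambda> W)"
proof -
  interpret fd_algebra k \<Lambda> by fact
  let ?U = "underlying_space \<Lambda>"
  interpret W: module k "?U W" by (rule module_underlying_space[OF k rm(3)])
  obtain A where A: "finite A" "A \<subseteq> carrier M" "carrier M \<subseteq> lin_combs k (?U M) A"
    using fd(1) by (auto simp: fin_dim_iff)
  obtain B where B: "finite B" "B \<subseteq> carrier Y" "carrier Y \<subseteq> lin_combs k (?U Y) B"
    using fd(2) by (auto simp: fin_dim_iff)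
  let ?C = "i ` A \<union> j ` B"
  have C: "finite ?C" "?C \<subseteq> carrier W"
    using A B mod_homD(1)[OF i] mod_homD(1)[OF j] by auto
  have image: "\<phi> ` carrier N \<subseteq> lin_combs k (?U W) ?C"
    if N: "right_module \<Lambda> N" and \<phi>: "\<phi> \<in> mod_hom \<Lambda> N W"
      and D: "finite D" "D \<subseteq> carrier N" "carrier N \<subseteq> lin_combs k (?U N) D" "\<phi> ` D \<subseteq> ?C" for N \<phi> D
  proof -
    interpret N: module k "?U N" by (rule module_underlying_space[OF k N])
    have "abelian_group_hom (?U N) (?U W) \<phi>"
      using mod_homD(1,2)[OF \<phi>]
      by (intro abelian_group_homI group_hom.intro group_hom_axioms.intro N.M.abelian_group_axioms
          W.M.abelian_group_axioms N.M.a_group W.M.a_group) (auto simp: hom_def)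
    then have "\<phi> ` lin_combs k (?U N) D \<subseteq> lin_combs k (?U W) ?C"
      using C D by (intro N.linear_image_lin_combs W.module_axioms) (auto simp: mod_homD[OF \<phi>])
    then show ?thesis using D(3) by blast
  qed
  have "carrier W \<subseteq> lin_combs k (?U W) ?C"
  proof
    fix w assume "w \<in> carrier W"
    then obtain m y where my: "m \<in> carrier M" "y \<in> carrier Y" "w = i m \<oplus>\<^bsub>W\<^esub> j y" using W by blast
    have "i m \<in> lin_combs k (?U W) ?C" "j y \<in> lin_combs k (?U W) ?C"
      using image[OF rm(1) i A] image[OF rm(2) j B] my by auto
    then show "w \<in> lin_combs k (?U W) ?C"
      using W.lin_combs_closed(2)[of ?C "i m" "j y"] C my by simp
  qed
  then show ?thesis using C by (auto simp: fin_dim_iff intro!: exI[of _ ?C])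
qed

section \<open>Factoring through the almost split sequence, and passing to classes\<close>

lemma exact_subcategoryD:
  assumes "exact_subcategory k \<Lambda> \<C>" "N \<in> \<C>"
  shows "right_module \<Lambda> N" "fin_dim k (underlying_space \<Lambda> N)"
  using assms by (auto simp: exact_subcategory_def mod_cat_def)

lemma exact_subcategory_extension:
  assumes "exact_subcategory k \<Lambda> \<C>" "X \<in> \<C>" "Z \<in> \<C>" "right_module \<Lambda> Y"
    "fin_dim k (underlying_space \<Lambda> Y)" "short_exact \<Lambda> X u Y v Z"
  shows "Y \<in> \<C>"
  using assms unfolding exact_subcategory_def mod_cat_def by blast

lemma hom_imageI:
  assumes "f \<in> extensional (carrier X)" "s \<in> mod_hom \<Lambda> Y N" "\<And>x. x \<in> carrier X \<Longrightarrow> f x = s (u x)"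
  shows "f \<in> hom_image \<Lambda> X u Y N"
  unfolding hom_image_def
  by (rule image_eqI[OF _ assms(2)])
    (rule extensionalityI[where A = "carrier X"], use assms in \<open>auto simp: compose_eq\<close>)

text \<open>The core of the argument, for maps instead of classes and for an arbitrary AR-sequence
  ending in \<open>Z\<close>, so that the choice of a translate does not enter.\<close>

lemma hom_factor_AR:
  fixes X Y Z M A B :: "('l, 'm) module"
  assumes inf: "infinite (UNIV :: 'm set)" and k: "fd_algebra k \<Lambda>"
    and ex_sub: "exact_subcategory k \<Lambda> \<C>"
    and ex_in: "short_exact_in \<Lambda> \<C> X u Y v Z" and M: "M \<in> \<C>"
    and AR: "AR_sequence \<Lambda> \<C> A a B b Z"
    and f: "f \<in> mod_hom \<Lambda> X M" "f \<notin> hom_image \<Lambda> X u Y M"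
  obtains g where "g \<in> mod_hom \<Lambda> M A" "compose (carrier X) g f \<notin> hom_image \<Lambda> X u Y A"
proof -
  have inC: "X \<in> \<C>" "Y \<in> \<C>" "Z \<in> \<C>" "A \<in> \<C>" "B \<in> \<C>" and ex: "short_exact \<Lambda> X u Y v Z"
    and exAR: "short_exact \<Lambda> A a B b Z" and ras: "right_almost_split \<Lambda> \<C> B Z b"
    using ex_in AR by (auto simp: short_exact_in_def AR_sequence_def)
  note rm = inC[THEN exact_subcategoryD(1)[OF ex_sub]] exact_subcategoryD(1)[OF ex_sub M]
  interpret X: right_module \<Lambda> X by fact
  interpret Y: right_module \<Lambda> Y by fact
  interpret Z: right_module \<Lambda> Z by fact
  interpret M: right_module \<Lambda> M by fact
  interpret B: right_module \<Lambda> B by fact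
  obtain W i j p where W: "right_module \<Lambda> W" "short_exact \<Lambda> M i W p Z" "j \<in> mod_hom \<Lambda> Y W"
    and ju: "\<And>x. x \<in> carrier X \<Longrightarrow> j (u x) = i (f x)"
    and pj: "\<And>y. y \<in> carrier Y \<Longrightarrow> p (j y) = v y"
    and W_sum: "\<And>w. w \<in> carrier W \<Longrightarrow> \<exists>m\<in>carrier M. \<exists>y\<in>carrier Y. w = i m \<oplus>\<^bsub>W\<^esub> j y"
    using pushout[OF inf rm(1-3) M.right_module_axioms ex f(1)] by metis
  interpret W: right_module \<Lambda> W by fact
  note u = short_exactD(1)[OF ex] and v = short_exactD(2)[OF ex]
  note i = short_exactD(1)[OF W(2)] and p = short_exactD(2)[OF W(2)]
  note a = short_exactD(1)[OF exAR] and b = short_exactD(2)[OF exAR]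
  note homs = mod_homD(1)[OF u] mod_homD(1)[OF v] mod_homD(1)[OF i] mod_homD(1)[OF p]
    mod_homD(1)[OF a] mod_homD(1)[OF b] mod_homD(1)[OF f(1)] mod_homD(1)[OF W(3)]
  interpret p: abelian_group_hom W Z p by (rule abelian_group_hom_mod_hom[OF W(1) rm(3) p])
  interpret b: abelian_group_hom B Z b by (rule abelian_group_hom_mod_hom[OF rm(5,3) b])
  \<comment> \<open>Extension-closedness speaks about finite dimensional middle terms only.
    Membership of \<open>W\<close> in \<open>\<C>\<close> is required because \<open>b\<close> is
    right almost split just for maps from objects of \<open>\<C>\<close>.\<close>
  have "fin_dim k (underlying_space \<Lambda> W)"
    using fin_dim_sum[OF k M.right_module_axioms Y.right_module_axioms W(1) _ _ i W(3) W_sum]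
      exact_subcategoryD(2)[OF ex_sub] M inC by blast
  then have WC: "W \<in> \<C>"
    using exact_subcategory_extension[OF ex_sub M inC(3) W(1) _ W(2)] by blast
  have "\<not> split_epi \<Lambda> W Z p"
  proof
    assume "split_epi \<Lambda> W Z p"
    then obtain s where s: "s \<in> mod_hom \<Lambda> Z W" and "compose (carrier Z) p s = (\<lambda>x\<in>carrier Z. x)"
      by (auto simp: split_epi_def)
    then have ps: "p (s z) = z" if "z \<in> carrier Z" for z
      using that by (metis compose_eq restrict_apply')
    interpret s: abelian_group_hom Z W s by (rule abelian_group_hom_mod_hom[OF rm(3) W(1) s])
    \<comment> \<open>This is \<open>j - s v\<close>. As \<open>p j = v = p s v\<close>, it takes
      values in the kernel of \<open>p\<close> and comes from some \<open>r\<close> into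
      \<open>M\<close>. On the image of \<open>u\<close> the term \<open>s v\<close> vanishes, so
      \<open>i r u = j u = i f\<close>, and \<open>r\<close> would extend \<open>f\<close> along
      \<open>u\<close>.\<close>
    define \<phi> where "\<phi> = (\<lambda>y\<in>carrier Y. j y \<ominus>\<^bsub>W\<^esub> compose (carrier Y) s v y)"
    have "\<phi> \<in> mod_hom \<Lambda> Y W"
      unfolding \<phi>_def by (rule mod_hom_diff[OF rm(2) W(1) W(3) mod_hom_compose[OF v s rm(2)]])
    moreover have "p (\<phi> y) = \<zero>\<^bsub>Z\<^esub>" if "y \<in> carrier Y" for y
      using that by (simp add: \<phi>_def compose_eq homs W.minus_eq pj ps Z.r_neg)
    ultimately obtain r where r: "r \<in> mod_hom \<Lambda> Y M" "\<And>y. y \<in> carrier Y \<Longrightarrow> i (r y) = \<phi> y"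
      using lift_through_kernel[OF M.right_module_axioms W(1) Y.right_module_axioms W(2)] by metis
    have "f x = r (u x)" if x: "x \<in> carrier X" for x
    proof (rule inj_onD[OF short_exactD(3)[OF W(2)]])
      show "i (f x) = i (r (u x))"
        using x by (simp add: r \<phi>_def compose_eq homs ju short_exactD(4)[OF ex] W.minus_eq)
    qed (use x r in \<open>auto simp: homs mod_homD\<close>)
    then show False using hom_imageI mod_homD(4)[OF f(1)] r f(2) by metis
  qed
  then obtain h where h: "h \<in> mod_hom \<Lambda> W B" and "compose (carrier W) b h = p"
    using ras WC p by (auto simp: right_almost_split_def)
  then have bh: "b (h w) = p w" if "w \<in> carrier W" for w
    using that by (metis compose_eq)
  have hi: "compose (carrier M) h i \<in> mod_hom \<Lambda> M B"
    using i h M.right_module_axioms by (rule mod_hom_compose)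
  \<comment> \<open>Since \<open>b h i = p i = 0\<close>, the composite \<open>h i\<close> lands in
    the image of \<open>a\<close>.\<close>
  obtain g where g: "g \<in> mod_hom \<Lambda> M A" "\<And>m. m \<in> carrier M \<Longrightarrow> a (g m) = h (i m)"
    by (rule lift_through_kernel[OF rm(4,5) M.right_module_axioms exAR hi])
      (auto simp: compose_eq bh homs short_exactD(4)[OF W(2)])
  have "compose (carrier X) g f \<notin> hom_image \<Lambda> X u Y A"
  proof
    assume "compose (carrier X) g f \<in> hom_image \<Lambda> X u Y A"
    then obtain s where s: "s \<in> mod_hom \<Lambda> Y A" and "compose (carrier X) g f = compose (carrier X) s u"
      by (auto simp: hom_image_def)
    then have su: "s (u x) = g (f x)" if "x \<in> carrier X" for x
      using that by (metis compose_eq)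
    \<comment> \<open>This is \<open>h j - a s\<close>; it kills \<open>u\<close> because
      \<open>h j u = h i f = a g f = a s u\<close>.\<close>
    define \<phi> where "\<phi> = (\<lambda>y\<in>carrier Y. compose (carrier Y) h j y \<ominus>\<^bsub>B\<^esub> compose (carrier Y) a s y)"
    have "\<phi> \<in> mod_hom \<Lambda> Y B"
      unfolding \<phi>_def by (rule mod_hom_diff[OF rm(2,5) mod_hom_compose[OF W(3) h rm(2)] mod_hom_compose[OF s a rm(2)]])
    moreover have "\<phi> (u x) = \<zero>\<^bsub>B\<^esub>" if "x \<in> carrier X" for x
      using that
      by (simp add: \<phi>_def compose_eq homs ju su g mod_homD[OF h] B.minus_eq B.r_neg)
    ultimately obtain t where t: "t \<in> mod_hom \<Lambda> Z B" "\<And>y. y \<in> carrier Y \<Longrightarrow> t (v y) = \<phi> y"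
      using descend_through_cokernel[OF rm(2,3) B.right_module_axioms ex] by metis
    \<comment> \<open>Here \<open>b h j = p j = v\<close> and \<open>b a = 0\<close>, so
      \<open>b t\<close> agrees with the identity on the image of \<open>v\<close>, which is all of
      \<open>Z\<close>.\<close>
    have btv: "b (t (v y)) = v y" if "y \<in> carrier Y" for y
      using that
      by (simp add: t \<phi>_def compose_eq homs mod_homD[OF h] mod_homD[OF s] B.minus_eq bh pj
          short_exactD(4)[OF exAR])
    have "b (t z) = z" if "z \<in> carrier Z" for z
      using that btv short_exactD(6)[OF ex] by (metis imageE)
    then have "compose (carrier Z) b t = (\<lambda>x\<in>carrier Z. x)"
      by (auto simp: compose_def intro!: restrict_ext)
    then show False using ras t(1) by (auto simp: right_almost_split_def split_epi_def)
  qed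
  with g(1) show thesis by (rule that)
qed

text \<open>The unit of the quotient group is the subgroup itself, and a coset contains its
  representative.\<close>

lemma cok_class_eq_one_iff:
  assumes "right_module \<Lambda> X" "right_module \<Lambda> Y" "right_module \<Lambda> M" "u \<in> mod_hom \<Lambda> X Y"
    and "f \<in> mod_hom \<Lambda> X M"
  shows "cok_class \<Lambda> X u Y M f = \<one>\<^bsub>Cok \<Lambda> X u Y M\<^esub> \<longleftrightarrow> f \<in> hom_image \<Lambda> X u Y M"
proof -
  interpret comm_group "hom_group \<Lambda> X M" by (rule comm_group_hom_group[OF assms(1,3)])
  have sub: "subgroup (hom_image \<Lambda> X u Y M) (hom_group \<Lambda> X M)"
    by (rule subgroup_hom_image[OF assms(1-4)])
  have "f \<in> carrier (hom_group \<Lambda> X M)" using assms by (simp add: hom_group_def)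
  then show ?thesis
    using rcos_self[OF _ sub, of f] coset_join2[OF _ sub, of f]
    by (auto simp: cok_class_def Cok_def FactGroup_def)
qed

text \<open>Infinitude of \<open>'m\<close> leaves room for a pushout with elements in
  \<open>'m\<close>. That the sequence does not split is expressed at \<open>v\<close>, the side
  that bears on projectivity of \<open>Z\<close>.\<close>

theorem proposition1p3:
  fixes k :: "('k, 'c) ring_scheme"
    and \<Lambda> :: "('k, 'l, 'd) module_scheme"
    and \<C> :: "('l, 'm) module set"
    and X Y Z M :: "('l, 'm) module"
    and u v :: "'m \<Rightarrow> 'm"
  assumes "infinite (UNIV :: 'm set)"
    and "fd_algebra k \<Lambda>"
    and "exact_subcategory k \<Lambda> \<C>"
    and "has_AR_sequences \<Lambda> \<C>"
    and "short_exact_in \<Lambda> \<C> X u Y v Z"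
    and "\<not> split_epi \<Lambda> Y Z v"
    and "indecomposable_in \<Lambda> \<C> Z"
    and "M \<in> \<C>"
  shows "\<forall>F \<in> carrier (Cok \<Lambda> X u Y M). F \<noteq> \<one>\<^bsub>Cok \<Lambda> X u Y M\<^esub> \<longrightarrow>
    (\<exists>g \<in> mod_hom \<Lambda> M (AR_translate \<Lambda> \<C> Z).
       comp_form \<Lambda> X u Y (AR_translate \<Lambda> \<C> Z) g F
         \<noteq> \<one>\<^bsub>Cok \<Lambda> X u Y (AR_translate \<Lambda> \<C> Z)\<^esub>)"
proof (intro ballI impI)
  have inC: "X \<in> \<C>" "Y \<in> \<C>" "Z \<in> \<C>" and ex: "short_exact \<Lambda> X u Y v Z"
    using assms(5) by (auto simp: short_exact_in_def)
  note rm = inC[THEN exact_subcategoryD(1)[OF assms(3)]] exact_subcategoryD(1)[OF assms(3,8)]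
  note u = short_exactD(1)[OF ex]
  interpret Z: right_module \<Lambda> Z by fact
  \<comment> \<open>If \<open>Z\<close> were projective in \<open>\<C>\<close>, its identity would
    lift along \<open>v\<close>, giving a section of \<open>v\<close>.\<close>
  have "(\<lambda>x\<in>carrier Z. x) \<in> mod_hom \<Lambda> Z Z"
    by (rule mod_homI) (auto simp: Z.smult_closed)
  then have "\<not> projective_in \<Lambda> \<C> Z"
    using assms(5,6) unfolding projective_in_def split_epi_def by blast
  then have "\<exists>A a B b. AR_sequence \<Lambda> \<C> A a B b Z"
    using assms(4,7) by (auto simp: has_AR_sequences_def)
  \<comment> \<open>Existence turns the term picked by \<open>SOME\<close> into the actual start of
    an AR-sequence ending in \<open>Z\<close>.\<close>
  then have "\<exists>a B b. AR_sequence \<Lambda> \<C> (AR_translate \<Lambda> \<C> Z) a B b Z"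
    unfolding AR_translate_def by (rule someI_ex)
  then obtain a B b where AR: "AR_sequence \<Lambda> \<C> (AR_translate \<Lambda> \<C> Z) a B b Z" by blast
  then have rmA: "right_module \<Lambda> (AR_translate \<Lambda> \<C> Z)"
    using exact_subcategoryD(1)[OF assms(3)] by (auto simp: AR_sequence_def short_exact_in_def)
  fix F assume "F \<in> carrier (Cok \<Lambda> X u Y M)" and F1: "F \<noteq> \<one>\<^bsub>Cok \<Lambda> X u Y M\<^esub>"
  then obtain f where f: "f \<in> mod_hom \<Lambda> X M" "F = cok_class \<Lambda> X u Y M f"
    by (auto simp: Cok_def FactGroup_def RCOSETS_def cok_class_def hom_group_def)
  then have "f \<notin> hom_image \<Lambda> X u Y M"
    using F1 cok_class_eq_one_iff[OF rm(1,2,4) u] by blast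
  then obtain g where g: "g \<in> mod_hom \<Lambda> M (AR_translate \<Lambda> \<C> Z)"
    "compose (carrier X) g f \<notin> hom_image \<Lambda> X u Y (AR_translate \<Lambda> \<C> Z)"
    using hom_factor_AR[OF assms(1-3,5,8) AR f(1)] by blast
  show "\<exists>g \<in> mod_hom \<Lambda> M (AR_translate \<Lambda> \<C> Z). comp_form \<Lambda> X u Y (AR_translate \<Lambda> \<C> Z) g F
      \<noteq> \<one>\<^bsub>Cok \<Lambda> X u Y (AR_translate \<Lambda> \<C> Z)\<^esub>"
  proof (rule bexI[OF _ g(1)])
    have "compose (carrier X) g f \<in> mod_hom \<Lambda> X (AR_translate \<Lambda> \<C> Z)"
      using mod_hom_compose[OF f(1) g(1) rm(1)] .
    then show "comp_form \<Lambda> X u Y (AR_translate \<Lambda> \<C> Z) g F \<noteq> \<one>\<^bsub>Cok \<Lambda> X u Y (AR_translate \<Lambda> \<C> Z)\<^esub>"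
      using g(2) f(2) comp_form_class[OF rm(1,2,4) rmA u f(1) g(1)]
        cok_class_eq_one_iff[OF rm(1,2) rmA u] by simp
  qed
qed

end
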